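(* Fix $A>2$, and let $\nu$ be a probability measure supported on $[0,1]^2$ satisfying $\widehat{\nu}(\boldsymbol{\xi}) \ll_A (\log\|\boldsymbol{\xi}\|_\infty)^{-A}$ as $\|\boldsymbol{\xi}\|_\infty\to\infty$. Let $n_1,n_2,\ldots$ be a lacunary sequence of positive integers, and let $\psi:\mathbb{N}\to[0,1]$. Then $\nu(\mathcal{R}(\psi))=1$.
   Context: For $x\in\mathbb{R}$, $\|x\|$ denotes the distance from $x$ to the nearest integer. A sequence $(n_t)$ of positive integers is lacunary if there is $c>1$ with $n_{t+1}\ge c\, n_t$ for all $t\ge1$. The Fourier transform is $\widehat{\nu}(\boldsymbol{\xi}) = \int e(-\boldsymbol{\xi}\cdot\mathbf{x})\,d\nu(\mathbf{x})$ with $e(x)=e^{2\pi i x}$, considered at $\boldsymbol{\xi}\in\mathbb{Z}^2$; $\|\boldsymbol{\xi}\|_\infty=\max(|\xi_1|,|\xi_2|)$; $f\ll_A g$ means $|f|\le C|g|$ for some constant $C>0$ depending on $A$. For $(\alpha,\gamma)\in\mathbb{R}^2$ and $N\in\mathbb{N}$ put $$\mathcal{N}(\alpha,\gamma,\psi,N)=\#\{t\le N : \|n_t\alpha-\gamma\|\le\psi(n_t)\},\qquad \Psi(N)=\sum_{t\le N}\psi(n_t).$$ $\mathcal{R}(\psi)$ is the set of $(\alpha,\gamma)\in\mathbb{R}^2$ for which $$\mathcal{N}(\alpha,\gamma,\psi,N)=2\Psi(N)+O\left(\Psi(N)^{2/3}\left(\log(2+\Psi(N))\right)^3\right),$$ where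 the implied constant may depend on $(\alpha,\gamma)$, but not on $N$.
   Formalization: The formal statement additionally assumes ψ(n_t) ≤ 1/2 for all t ≥ 1; as stated the claim fails, e.g. for ψ = 1 every t is counted, so the count is N while 2Ψ(N) = 2N. *)

theory Defs
  imports "HOL-Probability.Probability" "HOL-Library.Landau_Symbols"
begin

definition dist_int :: "real \<Rightarrow> real" where
  "dist_int x = infdist x \<int>"

definition e :: "real \<Rightarrow> complex" where
  "e x = exp (2 * of_real pi * \<i> * of_real x)"

definition fourier :: "(real \<times> real) measure \<Rightarrow> real \<times> real \<Rightarrow> complex" where
  "fourier \<nu> \<xi> = (LINT x|\<nu>. e (- (\<xi> \<bullet> x)))"

definition sup_norm :: "int \<times> int \<Rightarrow> real" where
  "sup_norm \<xi> = real_of_int (max \<bar>fst \<xi>\<bar> \<bar>snd \<xi>\<bar>)"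

text \<open>
  The filter \<open>filtercomap sup_norm at_top\<close> on \<open>int \<times> int\<close> expresses that the sup norm of the
  frequency tends to infinity, with no restriction on the two coordinates separately. The implied
  constant may depend on the exponent and the measure.
\<close>

definition fourier_log_decay :: "real \<Rightarrow> (real \<times> real) measure \<Rightarrow> bool" where
  "fourier_log_decay A \<nu> \<longleftrightarrow>
     (\<lambda>\<xi>::int \<times> int. cmod (fourier \<nu> (of_int (fst \<xi>), of_int (snd \<xi>))))
       \<in> O[filtercomap sup_norm at_top](\<lambda>\<xi>. ln (sup_norm \<xi>) powr (- A))"

text \<open>
  Sequences are indexed from 1; the value \<open>n 0\<close> plays no role in any of the following notions.
\<close>

definition lacunary :: "(nat \<Rightarrow> nat) \<Rightarrow> bool" where
  "lacunary n \<longleftrightarrow> (\<exists>c>1::real. \<forall>t\<ge>1. real (n (Suc t)) \<ge> c * real (n t))"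

definition hit_count :: "(nat \<Rightarrow> nat) \<Rightarrow> real \<Rightarrow> real \<Rightarrow> (nat \<Rightarrow> real) \<Rightarrow> nat \<Rightarrow> nat" where
  "hit_count n \<alpha> \<gamma> \<psi> N = card {t \<in> {1..N}. dist_int (real (n t) * \<alpha> - \<gamma>) \<le> \<psi> (n t)}"

definition Psi :: "(nat \<Rightarrow> nat) \<Rightarrow> (nat \<Rightarrow> real) \<Rightarrow> nat \<Rightarrow> real" where
  "Psi n \<psi> N = (\<Sum>t=1..N. \<psi> (n t))"

text \<open>
  The constant \<open>C\<close> is uniform over all \<open>N\<close>, not only over sufficiently large ones. In particular,
  if \<open>Psi n \<psi> N = 0\<close> then the count has to vanish as well.
\<close>

definition regular_set :: "(nat \<Rightarrow> nat) \<Rightarrow> (nat \<Rightarrow> real) \<Rightarrow> (real \<times> real) set" where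
  "regular_set n \<psi> =
     {(\<alpha>, \<gamma>). \<exists>C. \<forall>N.
        \<bar>real (hit_count n \<alpha> \<gamma> \<psi> N) - 2 * Psi n \<psi> N\<bar>
          \<le> C * (Psi n \<psi> N powr (2 / 3) * ln (2 + Psi n \<psi> N) ^ 3)}"

end

theory Submission
  imports Defs "HOL-Real_Asymp.Real_Asymp"
begin

text \<open>
For a point \<open>x = (\<alpha>, \<gamma>)\<close> put \<open>X\<^sub>t = n\<^sub>t \<alpha> - \<gamma>\<close>. The number of hits is a sum of indicators
\<open>\<parallel>X\<^sub>t\<parallel> \<le> \<psi>(n\<^sub>t)\<close>, and the theorem is a strong law of large numbers for it. The proof estimates the
variance of this count and then uses Chebyshev's inequality and the Borel--Cantelli lemma along a
sparse set of times.

Almost surely no target of width zero is ever hit (\<open>phase_not_integer\<close>). Every other indicator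
lies between two trigonometric polynomials in \<open>X\<^sub>t\<close>, truncated and shifted Fourier series of
trapezoids of relative slope width \<open>\<delta>\<close> (\<open>trig_majorant\<close>, \<open>trig_minorant\<close>). Their constant term is \<open>2\<psi>(1 + O(\<delta>))\<close>, each coefficient is \<open>O(\<psi>)\<close>, and the \<open>\<ell>\<^sup>1\<close> norm of the coefficients is only
\<open>O(log(1/\<delta>))\<close>, uniformly in \<open>\<psi>\<close>.

The covariance of such polynomials in \<open>X\<^sub>s\<close> and \<open>X\<^sub>t\<close>, where \<open>s < t\<close>, is a combination of values of
the Fourier transform at \<open>(k n\<^sub>s \<plusminus> l n\<^sub>t, k \<plusminus> l)\<close> up to sign, with \<open>k, l \<ge> 1\<close>, and of products
of values at \<open>(k n\<^sub>s, k)\<close> and \<open>(l n\<^sub>t, l)\<close>, which are \<open>O(t\<^sup>-\<^sup>A)\<close>; frequencies with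
\<open>k = 0\<close> or \<open>l = 0\<close> drop out after centring. If \<open>|k n\<^sub>s - l n\<^sub>t| \<ge> n\<^sub>t/2\<close>, the logarithm of the
frequency is at least of order \<open>t\<close>, which gives \<open>O(t\<^sup>-\<^sup>A)\<close>. Since \<open>A > 2\<close>, the sum of these bounds over all
pairs \<open>s < t\<close> converges. For each \<open>k\<close> there is at most one other \<open>l\<close>. In this resonant case either
\<open>|k n\<^sub>s - l n\<^sub>t| \<ge> n\<^sub>s/2\<close>, or the second coordinate \<open>|k - l|\<close> is at least \<open>c\<^sup>t\<^sup>-\<^sup>s - 3/2\<close>,
where \<open>c > 1\<close> is the lacunarity ratio, so the bound is \<open>O(s\<^sup>-\<^sup>A + (t-s)\<^sup>-\<^sup>A)\<close>. A single \<open>l\<close>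
costs only \<open>O(\<psi>(n\<^sub>t))\<close>, so all resonant terms together
contribute \<open>O(\<Psi> log(1/\<delta>))\<close>. With \<open>\<delta> = 1/(2+\<Psi>)\<close> the second moment of the deviation is
\<open>O((1+\<Psi>) log(2+\<Psi>)\<^sup>2)\<close> (\<open>variance_of_hits\<close>).

Let \<open>N\<^sub>j\<close> be the first time at which \<open>\<Psi>\<close> reaches \<open>j\<^sup>3\<close>. The probability of a deviation above
\<open>j\<^sup>2 log\<^sup>2 j\<close> at \<open>N\<^sub>j\<close> is \<open>O(1/(j log\<^sup>2 j))\<close>, which is summable. Between consecutive times \<open>\<Psi>\<close> grows
by \<open>O(j\<^sup>2)\<close>, that is by \<open>O(\<Psi>\<^sup>2\<^sup>/\<^sup>3)\<close>, so monotonicity of the count fills the gaps; this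
interpolation is the source of the exponent \<open>2/3\<close> (\<open>count_asymptotics_from_variance\<close>).
\<close>

section \<open>Piecewise quadratic Fourier series\<close>

text \<open>
The dilogarithm on the closed unit disc; the term \<open>n = 0\<close> vanishes because \<open>1 / 0 = 0\<close>.
\<close>

definition dilog :: "complex \<Rightarrow> complex" where
  "dilog z = (\<Sum>n. (1 / (of_nat n)^2) * z ^ n)"

lemma summable_inverse_squares: "summable (\<lambda>n. 1 / (real n)^2)"
  using inverse_power_summable[of 2, where 'a=real] by (simp add: field_simps)

lemma uniform_limit_dilog:
  "uniform_limit (cball 0 1) (\<lambda>N z. \<Sum>n<N. (1 / (of_nat n)^2) * z ^ n) dilog sequentially"
  unfolding dilog_def
proof (rule Weierstrass_m_test[OF _ summable_inverse_squares])
  fix n :: nat and z :: complex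
  assume "z \<in> cball 0 1"
  then show "norm ((1 / (of_nat n)^2) * z ^ n) \<le> 1 / (real n)^2"
    by (auto simp: norm_mult norm_divide norm_power divide_simps power_le_one)
qed

lemma continuous_on_dilog: "continuous_on (cball 0 1) dilog"
  by (rule uniform_limit_theorem[OF _ uniform_limit_dilog])
     (intro always_eventually allI continuous_intros, simp)

lemma dilog_sums:
  assumes "norm z \<le> 1"
  shows "(\<lambda>n. (1 / (of_nat n)^2) * z ^ n) sums dilog z"
  unfolding dilog_def
  by (rule summable_sums, rule summable_comparison_test[OF _ summable_inverse_squares])
     (use assms in \<open>auto simp: norm_mult norm_divide norm_power divide_simps power_le_one intro!: exI[of _ 0]\<close>)

lemma dilog_has_derivative:
  assumes "norm z < 1" "z \<noteq> 0"
  shows "(dilog has_field_derivative - Ln (1 - z) / z) (at z)"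
proof -
  let ?c = "\<lambda>n. 1 / (of_nat n)^2 :: complex"
  have "summable (\<lambda>n. ?c n * 1 ^ n)"
    using dilog_sums[of 1] by (simp add: sums_iff)
  then have "((\<lambda>z. \<Sum>n. ?c n * z ^ n) has_field_derivative (\<Sum>n. diffs ?c n * z ^ n)) (at z)"
    by (rule termdiffs_strong) (use assms in auto)
  moreover have "(\<lambda>n. diffs ?c n * z ^ n) sums (- Ln (1 - z) / z)"
  proof -
    have "(\<lambda>n. - (z ^ n / of_nat n)) sums Ln (1 - z)"
      using Ln_series'[of "- z"] assms by simp
    then have "(\<lambda>n. - (z ^ Suc n / of_nat (Suc n))) sums Ln (1 - z)"
      by (subst sums_Suc_iff) simp
    from sums_divide[OF sums_minus[OF this], of z]
    have "(\<lambda>n. z ^ Suc n / of_nat (Suc n) / z) sums (- Ln (1 - z) / z)"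
      by (simp add: field_simps)
    moreover have "z ^ Suc n / of_nat (Suc n) / z = diffs ?c n * z ^ n" for n
      using assms by (simp add: diffs_def divide_simps power2_eq_square del: of_nat_Suc)
    ultimately show ?thesis by simp
  qed
  ultimately show ?thesis
    by (simp add: sums_iff dilog_def[abs_def])
qed

lemma Im_Ln_one_minus_cis:
  assumes "0 < t" "t < 2 * pi"
  shows "Im (Ln (1 - cis t)) = (t - pi) / 2"
proof -
  have s: "sin (t / 2) > 0" using assms by (intro sin_gt_zero) auto
  have "1 - cis t = of_real (2 * sin (t/2)) * cis ((t - pi) / 2)"
  proof -
    have d: "(t - pi) / 2 = t/2 - pi/2" by (simp add: field_simps)
    have c: "cos t = 1 - 2 * (sin (t/2))^2" using cos_double_sin[of "t/2"] by simp
    have si: "sin t = 2 * sin (t/2) * cos (t/2)" using sin_double[of "t/2"] by simp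
    show ?thesis
      unfolding d by (auto simp: complex_eq_iff cos_diff sin_diff c si power2_eq_square)
  qed
  also have "Ln \<dots> = Ln (of_real (2 * sin (t/2)) * exp (\<i> * of_real ((t - pi) / 2)))"
    by (simp add: cis_conv_exp)
  also have "\<dots> = of_real (ln (2 * sin (t/2))) + \<i> * of_real ((t - pi) / 2)"
    using s assms by (subst Ln_times_of_real) (auto simp: Ln_exp Ln_of_real simp del: of_real_mult)
  finally show ?thesis by simp
qed

text \<open>
On a circle of radius \<open>r < 1\<close> the derivative of \<open>t \<mapsto> Re (dilog (r e\<^sup>i\<^sup>t))\<close> is the argument of
\<open>1 - r e\<^sup>i\<^sup>t\<close>. As \<open>r \<rightarrow> 1\<close> this tends to \<open>(t - \<pi>) / 2\<close>, uniformly on \<open>[a, b]\<close> by compactness, so the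
increments of \<open>Re dilog\<close> on the unit circle are those of the primitive \<open>t\<^sup>2/4 - \<pi>t/2\<close>.
\<close>

lemma dilog_circle_increment:
  assumes "0 < a" "a \<le> b" "b < 2 * pi"
  shows "Re (dilog (cis b)) - Re (dilog (cis a)) = (b^2/4 - pi*b/2) - (a^2/4 - pi*a/2)"
proof -
  define H where "H = (\<lambda>p::real\<times>real. Im (Ln (1 - of_real (fst p) * cis (snd p))))"
  have nz: "1 - of_real r * cis t \<notin> \<real>\<^sub>\<le>\<^sub>0" if "0 \<le> r" "r \<le> 1" "a \<le> t" "t \<le> b" for r t
  proof
    assume *: "1 - of_real r * cis t \<in> \<real>\<^sub>\<le>\<^sub>0"
    then have 1: "1 \<le> r * cos t" "r * sin t = 0" by (auto simp: complex_nonpos_Reals_iff)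
    then have "r * cos t \<le> r * 1" using that by (intro mult_left_mono) auto
    with 1 that have "r = 1" by linarith
    with 1 have "cos t = 1" using cos_le_one[of t] by simp
    then obtain m :: int where "t = m * (2 * pi)" by (auto simp: cos_one_2pi_int)
    with that assms have "0 < m * (2*pi)" "m * (2 * pi) < 1 * (2 * pi)" by linarith+
    then have "0 < real_of_int m" "real_of_int m < 1"
      by (simp_all only: zero_less_mult_iff mult_less_cancel_right) auto
    then show False by simp
  qed
  have "continuous_on ({0..1} \<times> {a..b}) H"
    unfolding H_def using nz by (intro continuous_intros) auto
  then have uc: "uniformly_continuous_on ({0..1} \<times> {a..b}) H"
    by (intro compact_uniformly_continuous compact_Times) auto
  define G where "G = (\<lambda>r t. Re (dilog (of_real r * cis t)) - (t^2/4 - pi*t/2))"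
  \<comment> \<open>\<open>G r\<close> has a derivative of absolute value at most \<open>e\<close> on \<open>[a, b]\<close> once \<open>r\<close> is close to \<open>1\<close>.\<close>
  have near: "\<bar>G 1 b - G 1 a\<bar> \<le> e * (b - a)" if "e > 0" for e
  proof -
    from uc that obtain d where d: "d > 0"
      and dd: "\<And>x y. x \<in> {0..1} \<times> {a..b} \<Longrightarrow> y \<in> {0..1} \<times> {a..b} \<Longrightarrow> dist y x < d \<Longrightarrow> dist (H y) (H x) < e"
      unfolding uniformly_continuous_on_def by metis
    have step: "\<bar>G r b - G r a\<bar> \<le> e * (b - a)" if r: "max (1 - d) 0 < r" "r < 1" for r
    proof -
      have der: "(G r has_real_derivative (H (r,t) - (t - pi) / 2)) (at t)" if "a \<le> t" "t \<le> b" for t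
      proof -
        define z where "z = of_real r * cis t"
        have z: "norm z < 1" "z \<noteq> 0" using r by (auto simp: z_def norm_mult)
        have "((\<lambda>t. of_real r * cis t) has_vector_derivative (\<i> * z)) (at t)"
          unfolding z_def has_vector_derivative_def
          by (auto intro!: derivative_eq_intros simp: scaleR_conv_of_real algebra_simps)
        from field_vector_diff_chain_at[OF this, of dilog "- Ln (1 - z) / z"] dilog_has_derivative[OF z]
        have "((\<lambda>t. dilog (of_real r * cis t)) has_vector_derivative (\<i> * z) * (- Ln (1 - z) / z)) (at t)"
          by (simp add: z_def o_def)
        then have "((\<lambda>t. dilog (of_real r * cis t)) has_vector_derivative - \<i> * Ln (1 - z)) (at t)"
          using z by simp
        then have "((\<lambda>t. Re (dilog (of_real r * cis t))) has_real_derivative Re (- \<i> * Ln (1 - z))) (at t)"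
          by (metis has_real_derivative_iff_has_vector_derivative
              bounded_linear.has_vector_derivative[OF bounded_linear_Re])
        moreover have "((\<lambda>t. t^2/4 - pi*t/2) has_real_derivative (t - pi) / 2) (at t)"
          by (auto intro!: derivative_eq_intros simp: field_simps)
        ultimately have "((\<lambda>t. Re (dilog (of_real r * cis t)) - (t^2/4 - pi*t/2))
            has_real_derivative (Re (- \<i> * Ln (1 - z)) - (t - pi) / 2)) (at t)"
          by (rule DERIV_diff)
        then show ?thesis
          unfolding G_def H_def z_def by simp
      qed
      have bd: "\<bar>H (r,t) - (t - pi) / 2\<bar> \<le> e" if "a \<le> t" "t \<le> b" for t
      proof -
        have "H (1,t) = (t - pi)/2"
          using Im_Ln_one_minus_cis[of t] that assms by (simp add: H_def)
        moreover have "dist (H (r,t)) (H (1,t)) < e"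
          using that r d by (intro dd) (auto simp: dist_Pair_Pair dist_real_def)
        ultimately show ?thesis unfolding dist_real_def by linarith
      qed
      have "norm (G r b - G r a) \<le> e * norm (b - a)"
        by (rule field_differentiable_bound[where S = "{a..b}" and f' = "\<lambda>t. H (r,t) - (t - pi) / 2"])
           (use der bd assms in \<open>auto intro: DERIV_subset\<close>)
      then show ?thesis using assms by simp
    qed
    have tend: "((\<lambda>r. G r t) \<longlongrightarrow> G 1 t) (at_left 1)" for t
    proof -
      have "continuous_on {0..1} (\<lambda>r. dilog (of_real r * cis t))"
        by (rule continuous_on_compose2[OF continuous_on_dilog])
           (auto intro!: continuous_intros simp: norm_mult)
      then have "continuous_on {0..1} (\<lambda>r. G r t)"
        unfolding G_def by (intro continuous_intros)
      then have "((\<lambda>r. G r t) \<longlongrightarrow> G 1 t) (at 1 within {0..1})"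
        by (simp add: continuous_on_def)
      then show ?thesis by (simp add: at_within_Icc_at_left)
    qed
    have "((\<lambda>r. \<bar>G r b - G r a\<bar>) \<longlongrightarrow> \<bar>G 1 b - G 1 a\<bar>) (at_left 1)"
      by (intro tendsto_intros tend)
    moreover have "\<forall>\<^sub>F r in at_left 1. \<bar>G r b - G r a\<bar> \<le> e * (b - a)"
      using eventually_at_left_real[of "max (1 - d) 0" 1] d
      by (auto elim!: eventually_mono intro!: step)
    ultimately show ?thesis
      by (intro tendsto_upperbound[where F = "at_left 1"]) auto
  qed
  have "\<bar>G 1 b - G 1 a\<bar> \<le> 0"
  proof (rule field_le_epsilon)
    fix e :: real assume "e > 0"
    have "\<bar>G 1 b - G 1 a\<bar> \<le> (e / (b - a + 1)) * (b - a)"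
      using near[of "e / (b - a + 1)"] \<open>e > 0\<close> assms by simp
    also have "\<dots> \<le> 0 + e" using \<open>e > 0\<close> assms by (simp add: field_simps)
    finally show "\<bar>G 1 b - G 1 a\<bar> \<le> 0 + e" .
  qed
  then show ?thesis by (simp add: G_def)
qed

lemma Re_dilog_cis:
  "\<exists>c. \<forall>t\<in>{0..2*pi}. Re (dilog (cis t)) = c + (t^2/4 - pi*t/2)"
proof -
  define h where "h = (\<lambda>t. Re (dilog (cis t)) - (t^2/4 - pi*t/2))"
  have cont: "continuous_on {0..2*pi} h"
    unfolding h_def
    by (intro continuous_intros continuous_on_compose2[OF continuous_on_dilog]) auto
  have int: "h t = h pi" if "t \<in> {0<..<2*pi}" for t
  proof (cases "t \<le> pi")
    case True
    then show ?thesis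
      using dilog_circle_increment[of t pi] that pi_gt_zero unfolding h_def by simp
  next
    case False
    then show ?thesis
      using dilog_circle_increment[of pi t] that pi_gt_zero unfolding h_def by simp
  qed
  have "h t = h pi" if "t \<in> {0..2*pi}" for t
  proof (rule continuous_constant_on_closure[of "{0<..<2*pi}" h "h pi" t])
    have cl: "closure {0<..<2*pi} = {0..2*pi}" by (rule closure_greaterThanLessThan) simp
    show "continuous_on (closure {0<..<2*pi}) h" "t \<in> closure {0<..<2*pi}"
      using cont that unfolding cl by auto
  qed (rule int)
  then show ?thesis
    by (intro exI[of _ "h pi"]) (auto simp: h_def algebra_simps)
qed

text \<open>
The value of the constant (\<open>\<pi>\<^sup>2/6\<close>) is left open: only combinations of translates whose weights
sum to zero are used later.
\<close>

lemma cos_series: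
  "\<exists>c. \<forall>x. \<bar>x\<bar> \<le> 1 \<longrightarrow> (\<lambda>k. cos (2 * pi * real k * x) / (real k)^2) sums (c + pi^2 * (x^2 - \<bar>x\<bar>))"
proof -
  obtain c where c: "\<And>t. t\<in>{0..2*pi} \<Longrightarrow> Re (dilog (cis t)) = c + (t^2/4 - pi*t/2)"
    using Re_dilog_cis by blast
  have "(\<lambda>k. cos (2 * pi * real k * x) / (real k)^2) sums (c + pi^2 * (x^2 - \<bar>x\<bar>))" if "\<bar>x\<bar> \<le> 1" for x
  proof -
    define t where "t = 2 * pi * \<bar>x\<bar>"
    have t: "t \<in> {0..2*pi}" using that by (auto simp: t_def)
    have "(\<lambda>n. Re ((1 / (of_nat n)^2) * cis t ^ n)) sums Re (dilog (cis t))"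
      by (intro sums_Re dilog_sums) simp
    moreover have "Re ((1 / (of_nat n)^2) * cis t ^ n) = cos (2 * pi * real n * x) / (real n)^2" for n
    proof -
      have "(1 / (of_nat n)^2) * cis t ^ n = of_real (1 / (real n)^2) * cis (real n * t)"
        by (simp add: Complex.DeMoivre)
      also have "Re \<dots> = cos (real n * t) / (real n)^2" by (simp del: of_real_divide of_real_power)
      also have "cos (real n * t) = cos (2 * pi * real n * x)"
        by (cases "x \<ge> 0") (auto simp: t_def mult_ac)
      finally show ?thesis .
    qed
    moreover have "Re (dilog (cis t)) = c + pi^2 * (x^2 - \<bar>x\<bar>)"
      using c[OF t] by (simp add: t_def power2_eq_square algebra_simps)
    ultimately show ?thesis by (simp only:)
  qed
  then show ?thesis by blast
qed

section \<open>Trigonometric majorants and minorants of an interval\<close>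

definition trig_poly :: "(nat \<Rightarrow> real) \<Rightarrow> nat \<Rightarrow> real \<Rightarrow> real" where
  "trig_poly a K x = a 0 + (\<Sum>k=1..K. a k * cos (2 * pi * real k * x))"

text \<open>
What a trigonometric polynomial that approximates the indicator of \<open>\<parallel>x\<parallel> \<le> w\<close> with relative
precision \<open>\<delta>\<close> must satisfy. The last clause bounds the second moment of the polynomial by its
mean. It allows for the small negative values of minorants.
\<close>

definition admissible_coeffs :: "real \<Rightarrow> real \<Rightarrow> nat \<Rightarrow> (nat \<Rightarrow> real) \<Rightarrow> bool" where
  "admissible_coeffs w \<delta> K a \<longleftrightarrow>
     \<bar>a 0 - 2 * w\<bar> \<le> 2 * \<delta> * w \<and> (\<forall>k\<in>{1..K}. \<bar>a k\<bar> \<le> 8 * w) \<and>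
     (\<Sum>k=1..K. \<bar>a k\<bar>) \<le> 16 * ln (4 / \<delta>) \<and>
     (\<forall>x. (trig_poly a K x)\<^sup>2 \<le> 2 * trig_poly a K x + 8 * w)"

text \<open>
Makes \<open>dist_int x\<close> a translate of \<open>x\<close> by an integer, up to sign, so that even \<open>1\<close>-periodic functions
of \<open>x\<close> are functions of \<open>dist_int x\<close>.
\<close>

lemma dist_int_eq_abs_round: "dist_int x = \<bar>x - of_int (round x)\<bar>"
proof -
  have "infdist x \<int> \<le> dist x (of_int (round x))" by (rule infdist_le) simp
  moreover have "\<bar>x - of_int (round x)\<bar> \<le> infdist x \<int>"
  proof -
    have "infdist x \<int> = (INF a\<in>\<int>. dist x a)" by (rule infdist_notempty) auto
    moreover have "\<bar>x - of_int (round x)\<bar> \<le> (INF a\<in>\<int>. dist x a)"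
      by (rule cINF_greatest) (auto simp: dist_real_def elim!: Ints_cases intro: round_diff_minimal)
    ultimately show ?thesis by simp
  qed
  ultimately show ?thesis by (simp add: dist_int_def dist_real_def)
qed

lemma dist_int_bounds: "0 \<le> dist_int x" "dist_int x \<le> 1 / 2"
  using of_int_round_abs_le[of x] by (auto simp: dist_int_eq_abs_round abs_minus_commute)

lemma cos_dist_int: "cos (2 * pi * real k * dist_int x) = cos (2 * pi * real k * x)"
proof -
  have "cos (2 * pi * real k * dist_int x) = cos (2 * pi * real k * (x - of_int (round x)))"
  proof (cases "x - of_int (round x) \<ge> 0")
    case False
    then have "2 * pi * real k * dist_int x = - (2 * pi * real k * (x - of_int (round x)))"
      by (simp add: dist_int_eq_abs_round algebra_simps)
    then show ?thesis by (simp only: cos_minus)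
  qed (simp add: dist_int_eq_abs_round)
  also have "\<dots> = cos (2 * pi * real k * x - 2 * pi * of_int (int k * round x))"
    by (simp add: algebra_simps)
  also have "\<dots> = cos (2 * pi * real k * x)"
    by (simp only: cos_diff cos_int_2pin sin_int_2pin mult_1_right mult_zero_right add_0_right)
  finally show ?thesis .
qed

lemma trig_poly_dist_int: "trig_poly a K (dist_int x) = trig_poly a K x"
  by (simp add: trig_poly_def cos_dist_int)

text \<open>
Cosine coefficients of the even, \<open>1\<close>-periodic trapezoid that is \<open>1\<close> for \<open>\<parallel>x\<parallel> \<le> p\<close>, is \<open>0\<close> for
\<open>\<parallel>x\<parallel> \<ge> q\<close>, and is linear in between.
\<close>

definition trapezoid_coeff :: "real \<Rightarrow> real \<Rightarrow> nat \<Rightarrow> real" where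
  "trapezoid_coeff p q k =
     (if k = 0 then p + q
      else (cos (2 * pi * real k * p) - cos (2 * pi * real k * q)) / (pi\<^sup>2 * (real k)\<^sup>2 * (q - p)))"

text \<open>
The second derivative of the trapezoid consists of point masses at \<open>\<plusminus>p\<close> and \<open>\<plusminus>q\<close>. The trapezoid is
therefore a combination of the translates by \<open>\<plusminus>p\<close> and \<open>\<plusminus>q\<close> of the quadratic function in \<open>cos_series\<close>,
and the identity \<open>|y + r| + |y - r| = 2 max y r\<close> evaluates it.
\<close>

lemma trapezoid_sums:
  assumes "0 < p" "p < q" "q \<le> 1/2" "0 \<le> y" "y \<le> 1/2"
  shows "(\<lambda>k. trapezoid_coeff p q k * cos (2 * pi * real k * y)) sums ((max y q - max y p) / (q - p))"
proof -
  obtain c where c: "\<And>x. \<bar>x\<bar> \<le> 1 \<Longrightarrow>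
      (\<lambda>k. cos (2 * pi * real k * x) / (real k)^2) sums (c + pi^2 * (x^2 - \<bar>x\<bar>))"
    using cos_series by blast
  define u where "u = 1 / (2 * pi^2 * (q - p))"
  let ?v = "\<lambda>x. c + pi^2 * (x^2 - \<bar>x\<bar>)"
  let ?f = "\<lambda>x k. cos (2 * pi * real k * x) / (real k)^2"
  have s: "?f (y+p) sums ?v (y+p)" "?f (y-p) sums ?v (y-p)" "?f (y+q) sums ?v (y+q)" "?f (y-q) sums ?v (y-q)"
    by (rule c; use assms in linarith)+
  have "(\<lambda>k. (if k = 0 then p + q else 0) +
          u * ((?f (y+p) k + ?f (y-p) k) - (?f (y+q) k + ?f (y-q) k)))
        sums ((p + q) + u * ((?v (y+p) + ?v (y-p)) - (?v (y+q) + ?v (y-q))))"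
    by (intro sums_add sums_mult sums_diff s sums_single)
  moreover have "(if k = 0 then p + q else 0) + u * ((?f (y+p) k + ?f (y-p) k) - (?f (y+q) k + ?f (y-q) k))
      = trapezoid_coeff p q k * cos (2 * pi * real k * y)" for k
  proof (cases "k = 0")
    case True
    then show ?thesis by (simp add: trapezoid_coeff_def)
  next
    case False
    have e: "cos (2 * pi * real k * (y + r)) + cos (2 * pi * real k * (y - r)) =
             2 * cos (2 * pi * real k * y) * cos (2 * pi * real k * r)" for r
      by (simp add: distrib_left right_diff_distrib cos_add cos_diff)
    have "u * ((?f (y+p) k + ?f (y-p) k) - (?f (y+q) k + ?f (y-q) k))
       = u * ((cos (2 * pi * real k * (y + p)) + cos (2 * pi * real k * (y - p)))
             - (cos (2 * pi * real k * (y + q)) + cos (2 * pi * real k * (y - q)))) / (real k)^2"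
      by (simp add: add_divide_distrib diff_divide_distrib algebra_simps)
    also have "\<dots> = trapezoid_coeff p q k * cos (2 * pi * real k * y)"
      using False assms unfolding e u_def trapezoid_coeff_def by (simp add: field_simps)
    finally show ?thesis using False by simp
  qed
  moreover have "(p + q) + u * ((?v (y+p) + ?v (y-p)) - (?v (y+q) + ?v (y-q))) = (max y q - max y p) / (q - p)"
  proof -
    have a: "\<bar>y + r\<bar> + \<bar>y - r\<bar> = 2 * max y r" if "r > 0" for r using that assms by auto
    have "(?v (y+p) + ?v (y-p)) - (?v (y+q) + ?v (y-q)) =
       pi^2 * (2 * p^2 - 2 * q^2 - (\<bar>y+p\<bar> + \<bar>y-p\<bar>) + (\<bar>y+q\<bar> + \<bar>y-q\<bar>))"
      by (simp add: power2_eq_square algebra_simps)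
    also have "\<dots> = 2 * pi^2 * (max y q - max y p - (q - p) * (p + q))"
      using a[of p] a[of q] assms by (simp add: power2_eq_square algebra_simps)
    finally have eq: "(?v (y+p) + ?v (y-p)) - (?v (y+q) + ?v (y-q))
        = 2 * pi^2 * (max y q - max y p - (q - p) * (p + q))" .
    have "u * (2 * pi^2) = 1 / (q - p)" by (simp add: u_def)
    then have "u * (2 * pi^2 * (max y q - max y p - (q - p) * (p + q)))
        = (max y q - max y p - (q - p) * (p + q)) / (q - p)"
      by (simp only: mult.assoc[symmetric]) simp
    also have "\<dots> = (max y q - max y p) / (q - p) - (p + q)"
      using assms by (simp add: diff_divide_distrib)
    finally show ?thesis unfolding eq by simp
  qed
  ultimately show ?thesis by simp
qed

text \<open>
The coefficient is a product of two sines, of \<open>\<pi>k(q+p)\<close> and of \<open>\<pi>k(q-p)\<close>. The three bounds come from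
estimating both, one, or neither of them by its argument.
\<close>

lemma trapezoid_coeff_bounds:
  assumes "0 < p" "p < q" "k > 0"
  shows "\<bar>trapezoid_coeff p q k\<bar> \<le> 2 * (p + q)"
    and "\<bar>trapezoid_coeff p q k\<bar> \<le> 2 * (1 / real k)"
    and "\<bar>trapezoid_coeff p q k\<bar> \<le> 2 * (1 / ((real k)\<^sup>2 * (q - p)))"
proof -
  define s t where "s = \<bar>sin (pi * real k * (q + p))\<bar>" and "t = \<bar>sin (pi * real k * (q - p))\<bar>"
  have "cos (2 * pi * real k * p) - cos (2 * pi * real k * q)
      = 2 * sin (pi * real k * (q + p)) * sin (pi * real k * (q - p))"
    using cos_add[of "pi * real k * (q + p)" "pi * real k * (q - p)"]
      cos_diff[of "pi * real k * (q + p)" "pi * real k * (q - p)"]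
    by (simp add: algebra_simps)
  then have eq: "\<bar>trapezoid_coeff p q k\<bar> = 2 * s * t / (pi\<^sup>2 * (real k)\<^sup>2 * (q - p))"
    using assms by (simp add: trapezoid_coeff_def s_def t_def abs_mult)
  have s: "0 \<le> s" "s \<le> 1" "s \<le> pi * real k * (q + p)"
    using assms abs_sin_x_le_abs_x[of "pi * real k * (q + p)"] by (auto simp: s_def)
  have t: "0 \<le> t" "t \<le> 1" "t \<le> pi * real k * (q - p)"
    using assms abs_sin_x_le_abs_x[of "pi * real k * (q - p)"] by (auto simp: t_def)
  have D: "0 < pi\<^sup>2 * (real k)\<^sup>2 * (q - p)" using assms by simp
  have pi1: "1 \<le> pi" using pi_ge_two by simp
  have "s * t \<le> (pi * real k * (q + p)) * (pi * real k * (q - p))"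
    using s t assms by (intro mult_mono) auto
  then show "\<bar>trapezoid_coeff p q k\<bar> \<le> 2 * (p + q)"
    unfolding eq pos_divide_le_eq[OF D] by (simp add: power2_eq_square algebra_simps)
  have "s * t \<le> 1 * (pi * real k * (q - p))"
    using s t assms by (intro mult_mono) auto
  also have "\<dots> \<le> pi * (pi * real k * (q - p))"
    using pi1 assms by (intro mult_right_mono) auto
  finally show "\<bar>trapezoid_coeff p q k\<bar> \<le> 2 * (1 / real k)"
  proof -
    assume "s * t \<le> pi * (pi * real k * (q - p))"
    also have "\<dots> = (1 / real k) * (pi\<^sup>2 * (real k)\<^sup>2 * (q - p))"
      using assms(3) by (simp add: power2_eq_square)
    finally show ?thesis
      unfolding eq pos_divide_le_eq[OF D] by simp
  qed
  have "s * t \<le> 1 * 1" using s t by (intro mult_mono) auto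
  also have "1 * 1 \<le> pi\<^sup>2" using pi1 by (simp add: one_le_power)
  finally show "\<bar>trapezoid_coeff p q k\<bar> \<le> 2 * (1 / ((real k)\<^sup>2 * (q - p)))"
    unfolding eq using D assms by (simp add: divide_simps mult_ac)
qed

lemma trapezoid_approx:
  assumes "0 < p" "p < q" "q \<le> 1/2" "\<epsilon> > 0"
  shows "\<exists>K. \<forall>x. \<bar>trig_poly (trapezoid_coeff p q) K x - (max (dist_int x) q - max (dist_int x) p) / (q - p)\<bar> \<le> \<epsilon>"
proof -
  let ?f = "\<lambda>k y. trapezoid_coeff p q k * cos (2 * pi * real k * y)"
  let ?M = "\<lambda>k. (if k = 0 then p + q else 0) + 2 / (q - p) * (1 / (real k)^2)"
  have "uniform_limit {0..1/2} (\<lambda>N y. \<Sum>k<N. ?f k y) (\<lambda>y. \<Sum>k. ?f k y) sequentially"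
  proof (rule Weierstrass_m_test)
    show "summable ?M" by (intro summable_add summable_mult summable_inverse_squares summable_single)
    fix k y
    have "\<bar>trapezoid_coeff p q k\<bar> \<le> ?M k"
      using trapezoid_coeff_bounds(3)[of p q k] assms
      by (cases "k = 0") (auto simp: trapezoid_coeff_def field_simps)
    moreover have "\<bar>?f k y\<bar> \<le> \<bar>trapezoid_coeff p q k\<bar> * 1"
      unfolding abs_mult by (intro mult_left_mono) auto
    ultimately show "norm (?f k y) \<le> ?M k" by simp
  qed
  from uniform_limitD[OF this \<open>\<epsilon> > 0\<close>] obtain N where
    N: "\<And>n y. n \<ge> N \<Longrightarrow> y \<in> {0..1/2} \<Longrightarrow> dist (\<Sum>k<n. ?f k y) (\<Sum>k. ?f k y) < \<epsilon>"
    unfolding eventually_sequentially by blast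
  show ?thesis
  proof (intro exI[of _ N] allI)
    fix x
    have "(\<Sum>k. ?f k (dist_int x)) = (max (dist_int x) q - max (dist_int x) p) / (q - p)"
      using trapezoid_sums[of p q "dist_int x"] assms dist_int_bounds by (simp add: sums_iff)
    moreover have "(\<Sum>k<Suc N. ?f k (dist_int x)) = trig_poly (trapezoid_coeff p q) N x"
      unfolding trig_poly_dist_int[of _ _ x, symmetric] unfolding trig_poly_def lessThan_Suc_atMost
      by (subst sum.atMost_shift) (simp add: sum.atLeast1_atMost_eq)
    ultimately show "\<bar>trig_poly (trapezoid_coeff p q) N x - (max (dist_int x) q - max (dist_int x) p) / (q - p)\<bar> \<le> \<epsilon>"
      using N[of "Suc N" "dist_int x"] dist_int_bounds[of x] by (simp add: dist_real_def)
  qed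
qed

text \<open>
The three bounds on \<open>c k\<close> are sharp on the ranges \<open>k \<le> 1/s\<close>, \<open>1/s \<le> k \<le> 1/\<eta>\<close> and \<open>k \<ge> 1/\<eta>\<close>; only
the middle one is long, and it contributes \<open>ln (s/\<eta>)\<close>. Instead of splitting the sum, \<open>c k\<close> is
compared with the difference of \<open>1/(k + 1/s)\<close> and \<open>1/(k + 1/\<eta>)\<close>, which has the same shape and is
dominated by a telescoping difference of logarithms.
\<close>

lemma sum_le_ln_of_decay:
  fixes c :: "nat \<Rightarrow> real"
  assumes pos: "0 < \<eta>" "2 * \<eta> \<le> s"
    and c: "\<And>k. k > 0 \<Longrightarrow> c k \<le> s" "\<And>k. k > 0 \<Longrightarrow> c k \<le> 1 / real k"
      "\<And>k. k > 0 \<Longrightarrow> c k \<le> 1 / ((real k)\<^sup>2 * \<eta>)"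
  shows "(\<Sum>k=1..K. c k) \<le> 8 * ln (s + s / \<eta>)"
proof -
  define P Q where "P = 1 / s" and "Q = 1 / \<eta>"
  have PQ: "0 < P" "2 * P \<le> Q" using pos by (auto simp: P_def Q_def field_simps)
  have term_le: "c k \<le> 8 * ((ln (real k + P) - ln (real (k - 1) + P)) - (ln (real (Suc k) + Q) - ln (real k + Q)))"
    if "k > 0" for k
  proof -
    have diff: "1 / (real k + P) - 1 / (real k + Q) = (Q - P) / ((real k + P) * (real k + Q))"
      using that PQ by (simp add: field_simps)
    have "c k \<le> 8 * ((Q - P) / ((real k + P) * (real k + Q)))"
    proof (cases "real k \<le> P")
      case True
      have "(real k + P) * (real k + Q) \<le> (2 * P) * (2 * Q)"
        using True PQ by (intro mult_mono) auto
      moreover have "8 * (Q - P) \<ge> 4 * Q" using PQ by simp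
      ultimately have "4 * Q / ((2 * P) * (2 * Q)) \<le> 8 * (Q - P) / ((real k + P) * (real k + Q))"
        using PQ that by (intro frac_le) auto
      moreover have "4 * Q / ((2 * P) * (2 * Q)) = 1 / P" using PQ by simp
      moreover have "1 / P = s" by (simp add: P_def)
      ultimately show ?thesis using c(1)[OF that] by simp
    next
      case F: False
      show ?thesis
      proof (cases "real k \<le> Q")
        case True
        have "(real k + P) * (real k + Q) \<le> (2 * real k) * (2 * Q)"
          using True F PQ by (intro mult_mono) auto
        moreover have "8 * (Q - P) \<ge> 4 * Q" using PQ by simp
        ultimately have "4 * Q / ((2 * real k) * (2 * Q)) \<le> 8 * (Q - P) / ((real k + P) * (real k + Q))"
          using PQ that by (intro frac_le) auto
        moreover have "4 * Q / ((2 * real k) * (2 * Q)) = 1 / real k" using PQ that by simp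
        ultimately show ?thesis using c(2)[OF that] by simp
      next
        case False
        have "(real k + P) * (real k + Q) \<le> (2 * real k) * (2 * real k)"
          using False F PQ by (intro mult_mono) auto
        moreover have "8 * (Q - P) \<ge> 4 * Q" using PQ by simp
        ultimately have "4 * Q / ((2 * real k) * (2 * real k)) \<le> 8 * (Q - P) / ((real k + P) * (real k + Q))"
          using PQ that by (intro frac_le) auto
        moreover have "4 * Q / ((2 * real k) * (2 * real k)) = 1 / ((real k)\<^sup>2 * \<eta>)"
          using PQ that by (simp add: Q_def power2_eq_square)
        ultimately show ?thesis using c(3)[OF that] by simp
      qed
    qed
    also have "\<dots> = 8 * (1 / (real k + P) - 1 / (real k + Q))" by (simp add: diff)
    finally have "c k \<le> 8 * (1 / (real k + P) - 1 / (real k + Q))" .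
    moreover have "1 / (real k + P) \<le> ln (real k + P) - ln (real (k - 1) + P)"
    proof -
      have "ln ((real k - 1 + P) / (real k + P)) \<le> (real k - 1 + P) / (real k + P) - 1"
        using that PQ by (intro ln_le_minus_one divide_pos_pos) auto
      then show ?thesis using that PQ
        by (subst (asm) ln_div) (auto simp: field_simps of_nat_diff)
    qed
    moreover have "ln (real (Suc k) + Q) - ln (real k + Q) \<le> 1 / (real k + Q)"
    proof -
      have "ln ((real k + 1 + Q) / (real k + Q)) \<le> (real k + 1 + Q) / (real k + Q) - 1"
        using that PQ by (intro ln_le_minus_one divide_pos_pos) auto
      then show ?thesis using that PQ
        by (subst (asm) ln_div) (auto simp: field_simps)
    qed
    ultimately show ?thesis by argo
  qed
  have "(\<Sum>k=1..K. c k) \<le> (\<Sum>k=1..K. 8 * ((ln (real k + P) - ln (real (k - 1) + P)) - (ln (real (Suc k) + Q) - ln (real k + Q))))"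
    by (intro sum_mono term_le) auto
  also have "\<dots> = 8 * ((ln (real K + P) - ln P) - (ln (real (Suc K) + Q) - ln (1 + Q)))"
    by (induction K) (auto simp: algebra_simps)
  also have "\<dots> \<le> 8 * (ln (1 + Q) - ln P)" using PQ by simp
  also have "ln (1 + Q) - ln P = ln (s + s / \<eta>)"
  proof -
    have "ln (1 + Q) - ln P = ln ((1 + Q) / P)" using PQ by (simp add: ln_div)
    also have "(1 + Q) / P = s + s / \<eta>" using pos by (simp add: P_def Q_def field_simps)
    finally show ?thesis .
  qed
  finally show ?thesis by simp
qed

lemma trapezoid_coeff_l1:
  assumes "0 < p" "p < q" "q \<le> 1/2" "0 < \<delta>" "\<delta> \<le> 1/2" "p + q \<le> 5/2 * w" "q - p = \<delta> * w" "3/2 * w \<le> p + q"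
  shows "(\<Sum>k=1..K. \<bar>trapezoid_coeff p q k\<bar>) \<le> 16 * ln (4 / \<delta>)"
proof -
  have w: "0 < w" using assms by (smt (verit) zero_less_mult_pos)
  have "(\<Sum>k=1..K. \<bar>trapezoid_coeff p q k\<bar> / 2) \<le> 8 * ln ((p + q) + (p + q) / (q - p))"
  proof (rule sum_le_ln_of_decay)
    define d where "d = \<delta> * w"
    have "d \<le> 1/2 * w" unfolding d_def using assms(5) w by (intro mult_right_mono) auto
    then have "2 * d \<le> w" by simp
    moreover have "w \<le> 3/2 * w" using w by simp
    ultimately have "2 * d \<le> p + q" using assms(8) by (meson order_trans)
    moreover have "q - p = d" using assms(7) by (simp add: d_def)
    ultimately show "2 * (q - p) \<le> p + q" by simp
  qed (use trapezoid_coeff_bounds[OF assms(1,2)] assms in \<open>auto simp: field_simps\<close>)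
  moreover have "(p + q) + (p + q) / (q - p) \<le> 4 / \<delta>"
  proof -
    have "(p + q) / (q - p) \<le> (5/2 * w) / (\<delta> * w)"
      unfolding assms(7) using assms w by (intro divide_right_mono) auto
    also have "\<dots> = (5/2) / \<delta>" using w by simp
    finally have "(p + q) + (p + q) / (q - p) \<le> 1 + (5/2) / \<delta>" using assms by simp
    also have "\<dots> \<le> 4 / \<delta>" using assms by (simp add: field_simps)
    finally show ?thesis .
  qed
  then have "ln ((p + q) + (p + q) / (q - p)) \<le> ln (4 / \<delta>)"
    using assms by (intro ln_mono) (auto intro!: add_pos_pos divide_pos_pos)
  ultimately show ?thesis by (simp add: sum_divide_distrib[symmetric])
qed

text \<open>
Moving the constant term by at most \<open>\<delta>w\<close> absorbs the error of truncation and keeps the mean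
within \<open>2\<delta>w\<close> of \<open>2w\<close>.
\<close>

lemma admissible_trapezoid:
  assumes "0 < p" "p < q" "q \<le> 1/2" "0 < \<delta>" "\<delta> \<le> 1/2" "w \<le> 1/2" "q - p = \<delta> * w"
    "\<bar>p + q - 2 * w\<bar> \<le> \<delta> * w" "\<bar>\<epsilon>\<bar> \<le> \<delta> * w"
    and appr: "\<And>x. \<bar>trig_poly (trapezoid_coeff p q) K x - (max (dist_int x) q - max (dist_int x) p) / (q - p)\<bar> \<le> \<delta> * w"
  defines "a \<equiv> (\<lambda>k. trapezoid_coeff p q k + (if k = 0 then \<epsilon> else 0))"
  shows "admissible_coeffs w \<delta> K a"
    "trig_poly a K x = trig_poly (trapezoid_coeff p q) K x + \<epsilon>"
proof -
  have w: "0 < w" using assms by (smt (verit) zero_less_mult_pos)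
  have dw: "\<delta> * w \<le> 1/2 * w" "\<delta> * w \<le> 1/2 * (1/2)"
    using assms(4-6) w by (intro mult_mono; simp)+
  define d where "d = \<delta> * w"
  have tp: "trig_poly a K x = trig_poly (trapezoid_coeff p q) K x + \<epsilon>" for x
    unfolding trig_poly_def a_def by simp
  have "a 0 = p + q + \<epsilon>" by (simp add: a_def trapezoid_coeff_def)
  then have "\<bar>a 0 - 2 * w\<bar> \<le> 2 * \<delta> * w" using assms(8,9) by linarith
  moreover have "\<bar>a k\<bar> \<le> 8 * w" if "k \<in> {1..K}" for k
    using trapezoid_coeff_bounds(1)[of p q k] assms that dw by (simp add: a_def)
  moreover have "(\<Sum>k=1..K. \<bar>a k\<bar>) \<le> 16 * ln (4 / \<delta>)"
    using trapezoid_coeff_l1[of p q \<delta> w K] assms dw by (simp add: a_def)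
  moreover have "(trig_poly a K x)\<^sup>2 \<le> 2 * trig_poly a K x + 8 * w" for x
  proof -
    define g where "g = (max (dist_int x) q - max (dist_int x) p) / (q - p)"
    have "0 \<le> g" "g \<le> 1" using assms by (auto simp: g_def)
    then have b: "- 2 * (\<delta> * w) \<le> trig_poly a K x" "trig_poly a K x \<le> 1 + 2 * (\<delta> * w)"
      using appr[of x] assms(9) unfolding tp g_def[symmetric] by linarith+
    show ?thesis
    proof (cases "trig_poly a K x \<ge> 0")
      case True
      have "trig_poly a K x * trig_poly a K x \<le> 2 * trig_poly a K x"
        using True b dw by (intro mult_right_mono) auto
      then show ?thesis using w by (simp add: power2_eq_square)
    next
      case False
      have "(- trig_poly a K x) * (- trig_poly a K x) \<le> 1 * (- trig_poly a K x)"
        using False b dw by (intro mult_right_mono) auto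
      then show ?thesis using b dw w unfolding power2_eq_square d_def[symmetric] by linarith
    qed
  qed
  ultimately show "admissible_coeffs w \<delta> K a" by (auto simp: admissible_coeffs_def)
  show "trig_poly a K x = trig_poly (trapezoid_coeff p q) K x + \<epsilon>" by (rule tp)
qed

lemma admissible_coeffs_const:
  assumes "\<bar>c - 2 * w\<bar> \<le> 2 * \<delta> * w" "0 \<le> c" "c \<le> 1" "0 \<le> w" "0 < \<delta>" "\<delta> \<le> 1/2"
  shows "admissible_coeffs w \<delta> 0 (\<lambda>_. c)"
proof -
  have "c * c \<le> c" using assms mult_left_le by blast
  moreover have "ln (4 / \<delta>) \<ge> 0" using assms by (intro ln_ge_zero) (simp add: field_simps)
  ultimately show ?thesis using assms by (simp add: admissible_coeffs_def trig_poly_def power2_eq_square)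
qed

text \<open>
If the widened interval does not fit into a period, then \<open>w\<close> is so close to \<open>1/2\<close> that the
constant \<open>1\<close> is a sufficiently precise majorant. For \<open>w = 0\<close> the indicator is replaced by zero,
because no polynomial of mean zero dominates the indicator of the integers.
\<close>

lemma trig_majorant:
  assumes "0 \<le> w" "w \<le> 1/2" "0 < \<delta>" "\<delta> \<le> 1/2"
  shows "\<exists>K a. admissible_coeffs w \<delta> K a \<and> (\<forall>x. of_bool (w > 0 \<and> dist_int x \<le> w) \<le> trig_poly a K x)"
proof -
  consider "w = 0" | "w > 0" "w * (1 + \<delta>) > 1/2" | "w > 0" "w * (1 + \<delta>) \<le> 1/2" using assms by linarith
  then show ?thesis
  proof cases
    case 1
    have "admissible_coeffs w \<delta> 0 (\<lambda>_. 0)"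
      using 1 assms by (intro admissible_coeffs_const) auto
    then show ?thesis using 1 by (intro exI[of _ 0] exI[of _ "\<lambda>_. 0"]) (auto simp: trig_poly_def)
  next
    case 2
    have "admissible_coeffs w \<delta> 0 (\<lambda>_. 1)"
      using 2 assms by (intro admissible_coeffs_const) (auto simp: algebra_simps)
    then show ?thesis by (intro exI[of _ 0] exI[of _ "\<lambda>_. 1"]) (auto simp: trig_poly_def)
  next
    case 3
    define q where "q = w * (1 + \<delta>)"
    have q: "0 < w" "w < q" "q \<le> 1/2" "q - w = \<delta> * w" "\<bar>w + q - 2 * w\<bar> \<le> \<delta> * w" "\<bar>\<delta> * w\<bar> \<le> \<delta> * w" "\<delta> * w > 0"
      using 3 assms by (auto simp: q_def algebra_simps)
    obtain K where K: "\<And>x. \<bar>trig_poly (trapezoid_coeff w q) K x - (max (dist_int x) q - max (dist_int x) w) / (q - w)\<bar> \<le> \<delta> * w"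
      using trapezoid_approx[OF q(1-3,7)] by blast
    note adm = admissible_trapezoid[OF q(1-3) assms(3,4,2) q(4-6) K]
    have "of_bool (w > 0 \<and> dist_int x \<le> w) \<le>
        trig_poly (\<lambda>k. trapezoid_coeff w q k + (if k = 0 then \<delta> * w else 0)) K x" for x
    proof -
      have "of_bool (w > 0 \<and> dist_int x \<le> w) \<le> (max (dist_int x) q - max (dist_int x) w) / (q - w)"
        using q by auto
      then show ?thesis using K[of x] adm(2)[of x] by linarith
    qed
    then show ?thesis using adm(1) by blast
  qed
qed

lemma trig_minorant:
  assumes "0 \<le> w" "w \<le> 1/2" "0 < \<delta>" "\<delta> \<le> 1/2"
  shows "\<exists>K a. admissible_coeffs w \<delta> K a \<and> (\<forall>x. trig_poly a K x \<le> of_bool (w > 0 \<and> dist_int x \<le> w))"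
proof (cases "w = 0")
  case True
  have "admissible_coeffs w \<delta> 0 (\<lambda>_. 0)"
    using True assms by (intro admissible_coeffs_const) auto
  then show ?thesis using True by (intro exI[of _ 0] exI[of _ "\<lambda>_. 0"]) (auto simp: trig_poly_def)
next
  case False
  define p where "p = w * (1 - \<delta>)"
  have p: "0 < p" "p < w" "w \<le> 1/2" "w - p = \<delta> * w" "\<bar>p + w - 2 * w\<bar> \<le> \<delta> * w" "\<bar>- (\<delta> * w)\<bar> \<le> \<delta> * w" "\<delta> * w > 0"
    using False assms by (auto simp: p_def algebra_simps)
  obtain K where K: "\<And>x. \<bar>trig_poly (trapezoid_coeff p w) K x - (max (dist_int x) w - max (dist_int x) p) / (w - p)\<bar> \<le> \<delta> * w"
    using trapezoid_approx[OF p(1-3,7)] by blast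
  note adm = admissible_trapezoid[OF p(1-3) assms(3,4,2) p(4-6) K]
  have "trig_poly (\<lambda>k. trapezoid_coeff p w k + (if k = 0 then - (\<delta> * w) else 0)) K x
      \<le> of_bool (w > 0 \<and> dist_int x \<le> w)" for x
  proof -
    have "(max (dist_int x) w - max (dist_int x) p) / (w - p) \<le> of_bool (w > 0 \<and> dist_int x \<le> w)"
      using p(2) False assms(1) by (cases "dist_int x \<le> w") (auto simp: divide_simps)
    then show ?thesis using K[of x] adm(2)[of x] by linarith
  qed
  then show ?thesis using adm(1) by blast
qed

section \<open>From a variance bound to an almost sure asymptotic\<close>

definition error_scale :: "real \<Rightarrow> real" where
  "error_scale x = x powr (2 / 3) * ln (2 + x) ^ 3"

lemma error_scale_nonneg: "0 \<le> x \<Longrightarrow> 0 \<le> error_scale x"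
  by (simp add: error_scale_def)

lemma error_scale_pos: "0 < x \<Longrightarrow> 0 < error_scale x"
  by (simp add: error_scale_def)

lemma error_scale_mono: "0 \<le> x \<Longrightarrow> x \<le> y \<Longrightarrow> error_scale x \<le> error_scale y"
  unfolding error_scale_def by (intro mult_mono power_mono powr_mono2) auto

text \<open>
A bounded error can be absorbed into the scale because the scale is bounded below from the first
time when \<open>T\<close> is positive; before that time both sides vanish.
\<close>

lemma absorb_constant_error:
  fixes S T :: "nat \<Rightarrow> real"
  assumes T: "mono T" "\<And>N. 0 \<le> T N"
    and zero: "\<And>N. T N = 0 \<Longrightarrow> S N = 0"
    and bound: "\<And>N. \<bar>S N - 2 * T N\<bar> \<le> B + C * error_scale (T N)"
  shows "\<exists>C. \<forall>N. \<bar>S N - 2 * T N\<bar> \<le> C * error_scale (T N)"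
proof (cases "\<exists>N. T N > 0")
  case False
  then have "T N = 0" for N using T(2)[of N] by (metis less_eq_real_def)
  then show ?thesis using zero by (intro exI[of _ 0]) simp
next
  case True
  define N0 where "N0 = (LEAST N. T N > 0)"
  have N0: "T N0 > 0" using True unfolding N0_def by (rule LeastI_ex)
  define c0 where "c0 = error_scale (T N0)"
  have c0: "c0 > 0" using N0 by (simp add: c0_def error_scale_pos)
  have "\<bar>S N - 2 * T N\<bar> \<le> (\<bar>B\<bar> / c0 + \<bar>C\<bar>) * error_scale (T N)" for N
  proof (cases "T N > 0")
    case False
    then have "T N = 0" using T(2)[of N] by simp
    then show ?thesis using zero[of N] by (simp add: error_scale_def)
  next
    case True
    then have "N0 \<le> N" unfolding N0_def by (rule Least_le)
    then have c: "c0 \<le> error_scale (T N)"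
      unfolding c0_def using T N0 by (intro error_scale_mono) (auto dest: monoD)
    have "\<bar>B\<bar> = \<bar>B\<bar> / c0 * c0" using c0 by simp
    also have "\<dots> \<le> \<bar>B\<bar> / c0 * error_scale (T N)" using c c0 by (intro mult_left_mono) auto
    finally have 1: "B \<le> \<bar>B\<bar> / c0 * error_scale (T N)" by linarith
    have 2: "C * error_scale (T N) \<le> \<bar>C\<bar> * error_scale (T N)"
      using error_scale_nonneg[OF T(2)[of N]] by (intro mult_right_mono) auto
    show ?thesis using bound[of N] 1 2 by (simp add: distrib_right)
  qed
  then show ?thesis by blast
qed

definition cube_time :: "(nat \<Rightarrow> real) \<Rightarrow> nat \<Rightarrow> nat" where
  "cube_time T j = (LEAST N. real j ^ 3 \<le> T N)"

lemma cube_time: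
  assumes "T 0 = 0" "\<And>N. T (Suc N) \<le> T N + 1 / 2" "\<And>B. \<exists>N. B \<le> T N" "j > 0"
  shows "real j ^ 3 \<le> T (cube_time T j)" "T (cube_time T j) \<le> real j ^ 3 + 1 / 2"
proof -
  show *: "real j ^ 3 \<le> T (cube_time T j)"
    unfolding cube_time_def by (rule LeastI_ex) (rule assms)
  have "cube_time T j \<noteq> 0"
    using * assms(1,4) by (metis not_le of_nat_0_less_iff zero_less_power)
  then obtain N where N: "cube_time T j = Suc N" by (cases "cube_time T j") auto
  then have "\<not> real j ^ 3 \<le> T N"
    using not_less_Least[of N "\<lambda>N. real j ^ 3 \<le> T N"] by (simp add: cube_time_def)
  then show "T (cube_time T j) \<le> real j ^ 3 + 1 / 2"
    using assms(2)[of N] N by simp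
qed

text \<open>
For \<open>j\<^sup>3 \<le> T N < (j+1)\<^sup>3\<close> the time \<open>N\<close> lies between the cube times of \<open>j\<close> and \<open>j+1\<close>, and \<open>S N\<close> lies
between the values of \<open>S\<close> there. The growth of \<open>T\<close> between these times is \<open>O(j\<^sup>2)\<close>, which is
\<open>O(T\<^sup>2\<^sup>/\<^sup>3)\<close>.
\<close>

lemma interpolate_between_cube_times:
  fixes S T :: "nat \<Rightarrow> real"
  assumes T: "mono T" "T 0 = 0" "\<And>N. T (Suc N) \<le> T N + 1 / 2" "\<And>B. \<exists>N. B \<le> T N"
    and S: "mono S"
    and J: "3 \<le> J" "\<And>j. j \<ge> J \<Longrightarrow> \<bar>S (cube_time T j) - 2 * T (cube_time T j)\<bar> \<le> real j ^ 2 * ln (real j) ^ 2"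
    and N: "real J ^ 3 \<le> T N"
  shows "\<bar>S N - 2 * T N\<bar> \<le> 20 * error_scale (T N)"
proof -
  define x where "x = T N"
  define j where "j = nat \<lfloor>root 3 x\<rfloor>"
  have x0: "x \<ge> 0" using N order_trans[of 0 "real J ^ 3" x] by (simp add: x_def)
  have r0: "root 3 x \<ge> 0" using x0 by simp
  have j1: "real j \<le> root 3 x" using r0 by (simp add: j_def)
  have j2: "root 3 x < real (Suc j)" using r0 unfolding j_def by linarith
  have jx: "real j ^ 3 \<le> x" "x < real (Suc j) ^ 3"
  proof -
    have "real j ^ 3 \<le> root 3 x ^ 3" using j1 by (intro power_mono) auto
    then show "real j ^ 3 \<le> x" using x0 by simp
    have "root 3 x ^ 3 < real (Suc j) ^ 3" using j2 r0 by (intro power_strict_mono) auto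
    then show "x < real (Suc j) ^ 3" using x0 by simp
  qed
  have Jj: "J \<le> j"
  proof -
    have "root 3 (real J ^ 3) \<le> root 3 x" using N by (simp add: x_def)
    then have "real J \<le> root 3 x" by (simp add: real_root_power_cancel)
    then have "real J < real (Suc j)" using j2 by linarith
    then show ?thesis by simp
  qed
  have j3: "j \<ge> 3" using Jj J by simp
  define L where "L = ln (2 + x)"
  define q where "q = real j ^ 2"
  have q: "q \<ge> 9" "real j \<le> q / 3"
    using j3 mult_mono[of 3 "real j" 3 "real j"] mult_right_mono[of 3 "real j" "real j"]
    by (auto simp: q_def power2_eq_square)
  have jcube: "real j + 1 \<le> 2 + real j ^ 3"
    using self_le_power[of "real j" 3] j3 by linarith
  have L: "1 \<le> L" "ln (real j) \<le> L" "ln (real (Suc j)) \<le> L"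
  proof -
    have "exp 1 \<le> (3::real)" by (rule exp_le)
    then have "exp 1 \<le> 2 + x" using jx(1) jcube j3 by linarith
    then show "1 \<le> L" unfolding L_def using x0 by (subst ln_ge_iff) auto
    show "ln (real j) \<le> L" "ln (real (Suc j)) \<le> L"
      unfolding L_def using jx(1) jcube j3 x0 by (intro ln_mono; simp)+
  qed
  have LL: "1 \<le> L ^ 3" "L ^ 2 \<le> L ^ 3" "0 \<le> L ^ 2"
    using L(1) by (auto intro: power_increasing)
  have scale: "q * L ^ 3 \<le> error_scale x"
  proof -
    have "(real j ^ 3) powr (2/3) \<le> x powr (2/3)"
      using jx by (intro powr_mono2) auto
    moreover have "(real j ^ 3) powr (2/3) = q"
    proof -
      have "(real j ^ 3) powr (2/3) = (real j powr 3) powr (2/3)" using j3 by simp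
      also have "\<dots> = real j powr 2" by (subst powr_powr) simp
      also have "\<dots> = q" using j3 by (simp add: q_def)
      finally show ?thesis .
    qed
    ultimately show ?thesis
      unfolding error_scale_def L_def[symmetric] using LL L(1) by (intro mult_right_mono) auto
  qed
  have cube: "real (Suc j) ^ 3 \<le> real j ^ 3 + 5 * q"
  proof -
    have "real (Suc j) ^ 3 = real j ^ 3 + 3 * q + 3 * real j + 1"
      by (simp add: power3_eq_cube power2_eq_square q_def algebra_simps)
    then show ?thesis using q by linarith
  qed
  have dev: "real j ^ 2 * ln (real j) ^ 2 \<le> q * L ^ 3" "real (Suc j) ^ 2 * ln (real (Suc j)) ^ 2 \<le> 2 * q * L ^ 3"
  proof -
    have "real j ^ 2 * ln (real j) ^ 2 \<le> q * L ^ 2"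
      unfolding q_def using L j3 by (intro mult_left_mono power_mono) auto
    also have "\<dots> \<le> q * L ^ 3" using LL q by (intro mult_left_mono) auto
    finally show "real j ^ 2 * ln (real j) ^ 2 \<le> q * L ^ 3" .
    have "real (Suc j) ^ 2 = q + 2 * real j + 1"
      by (simp add: power2_eq_square q_def algebra_simps)
    then have "real (Suc j) ^ 2 \<le> 2 * q" using q by linarith
    then have "real (Suc j) ^ 2 * ln (real (Suc j)) ^ 2 \<le> 2 * q * L ^ 2"
      using L j3 q by (intro mult_mono power_mono) auto
    also have "\<dots> \<le> 2 * q * L ^ 3" using LL q by (intro mult_left_mono) auto
    finally show "real (Suc j) ^ 2 * ln (real (Suc j)) ^ 2 \<le> 2 * q * L ^ 3" .
  qed
  have qL: "q \<le> q * L ^ 3" using LL q by simp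
  note ct = cube_time[of T, OF T(2,3,4)]
  have ct_j: "real j ^ 3 \<le> T (cube_time T j)" using ct(1)[of j] j3 by simp
  have ct_Suc: "T (cube_time T (Suc j)) \<le> real (Suc j) ^ 3 + 1 / 2" using ct(2)[of "Suc j"] by simp
  have "cube_time T j \<le> N" unfolding cube_time_def by (rule Least_le) (use jx(1) in \<open>simp only: x_def\<close>)
  then have below: "S (cube_time T j) \<le> S N" by (rule monoD[OF S])
  have "N \<le> cube_time T (Suc j)"
  proof (rule ccontr)
    assume "\<not> ?thesis"
    then have "T (cube_time T (Suc j)) \<le> x" unfolding x_def by (intro monoD[OF T(1)]) linarith
    moreover have "real (Suc j) ^ 3 \<le> T (cube_time T (Suc j))" by (rule ct(1)) simp
    ultimately show False using jx(2) by (meson not_le order_trans)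
  qed
  then have above: "S N \<le> S (cube_time T (Suc j))" by (rule monoD[OF S])
  have sandwich: "\<bar>s - 2 * y\<bar> \<le> 13 * m"
    if "s1 \<le> s" "s \<le> s2" "\<bar>s1 - 2 * t1\<bar> \<le> m" "\<bar>s2 - 2 * t2\<bar> \<le> 2 * m" "c1 \<le> t1" "t2 \<le> c2 + 1 / 2"
      "c2 \<le> c1 + 5 * u" "c1 \<le> y" "y < c2" "u \<le> m" "9 \<le> u"
    for s s1 s2 t1 t2 c1 c2 m u y :: real
    using that by linarith
  have "\<bar>S N - 2 * x\<bar> \<le> 13 * (q * L ^ 3)"
  proof (rule sandwich[OF below above _ _ ct_j ct_Suc cube jx qL q(1)])
    show "\<bar>S (cube_time T j) - 2 * T (cube_time T j)\<bar> \<le> q * L ^ 3"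
      using J(2)[OF Jj] dev(1) by (rule order_trans)
    have "\<bar>S (cube_time T (Suc j)) - 2 * T (cube_time T (Suc j))\<bar> \<le> 2 * q * L ^ 3"
      using J(2)[OF le_SucI[OF Jj]] dev(2) by (rule order_trans)
    then show "\<bar>S (cube_time T (Suc j)) - 2 * T (cube_time T (Suc j))\<bar> \<le> 2 * (q * L ^ 3)"
      by (simp only: mult.assoc)
  qed
  also have "\<dots> \<le> 20 * error_scale x"
    using scale error_scale_nonneg[OF x0] by linarith
  finally show ?thesis by (simp only: x_def)
qed

text \<open>
Comparison with the telescoping series of \<open>1/ln j - 1/ln (j+1)\<close>.
\<close>

lemma summable_inverse_n_ln_squared: "summable (\<lambda>j. 1 / (real j * ln (real j) ^ 2))"
proof -
  have "summable (\<lambda>j. 1 / ln (real j) - 1 / ln (real (Suc j)))"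
    by (rule telescope_summable'[of _ 0]) real_asymp
  then have "summable (\<lambda>j. 1 / (real (Suc j) * ln (real (Suc j)) ^ 2))"
  proof (rule summable_comparison_test'[where N = 2])
    fix j :: nat assume j: "j \<ge> 2"
    have l: "0 < ln (real j)" "ln (real j) \<le> ln (real (Suc j))" using j by auto
    have "ln (real j / real (Suc j)) \<le> real j / real (Suc j) - 1"
      using j by (intro ln_le_minus_one) auto
    then have d: "1 / real (Suc j) \<le> ln (real (Suc j)) - ln (real j)"
      using j by (subst (asm) ln_div) (auto simp: field_simps)
    have "1 / (real (Suc j) * ln (real (Suc j)) ^ 2) = 1 / real (Suc j) / (ln (real (Suc j)) * ln (real (Suc j)))"
      by (simp add: power2_eq_square)
    also have "\<dots> \<le> (ln (real (Suc j)) - ln (real j)) / (ln (real j) * ln (real (Suc j)))"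
      using d l j by (intro frac_le mult_right_mono mult_pos_pos) auto
    also have "\<dots> = 1 / ln (real j) - 1 / ln (real (Suc j))"
      using l order_less_le_trans[OF l] by (simp add: diff_divide_distrib)
    finally show "norm (1 / (real (Suc j) * ln (real (Suc j)) ^ 2)) \<le> 1 / ln (real j) - 1 / ln (real (Suc j))"
      by simp
  qed
  then show ?thesis by (subst (asm) summable_Suc_iff)
qed

context prob_space begin

text \<open>
If \<open>T\<close> is unbounded, Chebyshev's inequality at the cube times gives probabilities of order
\<open>1/(j ln\<^sup>2 j)\<close> for deviations above \<open>j\<^sup>2 ln\<^sup>2 j\<close>, and almost surely only finitely many of them occur.
If \<open>T\<close> is bounded, the expected number of events is finite, so almost surely only finitely many
events occur at all and the deviation is bounded.
\<close>

lemma count_asymptotics_from_variance: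
  fixes A :: "nat \<Rightarrow> 'a set" and w :: "nat \<Rightarrow> real"
  defines "S \<equiv> \<lambda>N x. \<Sum>t=1..N. indicator (A t) x :: real" and "T \<equiv> \<lambda>N. \<Sum>t=1..N. w t"
  assumes A[measurable]: "\<And>t. A t \<in> events"
    and w: "\<And>t. t \<ge> 1 \<Longrightarrow> 0 \<le> w t" "\<And>t. t \<ge> 1 \<Longrightarrow> w t \<le> 1 / 2"
    and empty: "\<And>t. t \<ge> 1 \<Longrightarrow> w t = 0 \<Longrightarrow> A t = {}"
    and C: "0 \<le> C"
    and var: "\<And>N. expectation (\<lambda>x. (S N x - 2 * T N)\<^sup>2) \<le> C * (1 + T N) * ln (2 + T N) ^ 2"
  shows "AE x in M. \<exists>K. \<forall>N. \<bar>S N x - 2 * T N\<bar> \<le> K * error_scale (T N)"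
proof -
  have T: "mono T" "T 0 = 0" "\<And>N. T (Suc N) \<le> T N + 1 / 2" "\<And>N. 0 \<le> T N"
    using w by (auto simp: T_def intro!: incseq_SucI sum_nonneg)
  have S_mono: "mono (\<lambda>N. S N x)" for x by (auto simp: S_def incseq_SucI)
  have S_nonneg: "0 \<le> S N x" for N x by (auto simp: S_def sum_nonneg)
  have S_le: "S N x \<le> real N" for N x
    using sum_mono[of "{1..N}" "\<lambda>t. indicator (A t) x" "\<lambda>_. 1::real"] by (auto simp: S_def indicator_def)
  have zero: "S N x = 0" if "T N = 0" for N x
  proof -
    have "\<forall>t\<in>{1..N}. w t = 0"
      using that w(1) by (subst (asm) T_def, subst (asm) sum_nonneg_eq_0_iff) auto
    then show ?thesis using empty by (auto simp: S_def)
  qed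
  have [measurable]: "S N \<in> borel_measurable M" for N by (simp add: S_def)
  have indicator_int: "integrable M (indicator (A t) :: 'a \<Rightarrow> real)" for t
    by (rule integrable_const_bound[where B = 1]) (auto simp: indicator_def)
  have int: "integrable M (\<lambda>x. (S N x - 2 * T N)\<^sup>2)" for N
  proof (rule integrable_const_bound[where B = "(real N + 2 * T N)\<^sup>2"])
    have "(S N x - 2 * T N)\<^sup>2 \<le> (real N + 2 * T N)\<^sup>2" for x
      using S_nonneg[of N x] S_le[of N x] T(4)[of N] by (intro power2_le_iff_abs_le[THEN iffD2]) auto
    then show "AE x in M. norm ((S N x - 2 * T N)\<^sup>2) \<le> (real N + 2 * T N)\<^sup>2"
      by simp
  qed simp
  show ?thesis
  proof (cases "\<exists>B. \<forall>N. T N \<le> B")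
    case True
    then obtain B where B: "\<And>N. T N \<le> B" by blast
    have B0: "B \<ge> 0" using B[of 0] T by simp
    define D where "D = 2 * B + 1 + C * (1 + B) * ln (2 + B) ^ 2"
    have "(\<Sum>t=1..N. prob (A t)) \<le> D" for N
    proof -
      have "(\<Sum>t=1..N. prob (A t)) = expectation (S N)"
        unfolding S_def by (subst Bochner_Integration.integral_sum) (auto simp: indicator_int)
      also have "\<dots> \<le> expectation (\<lambda>x. 2 * T N + 1 + (S N x - 2 * T N)\<^sup>2)"
      proof (rule integral_mono)
        show "integrable M (S N)" unfolding S_def
          by (intro Bochner_Integration.integrable_sum indicator_int)
        show "S N x \<le> 2 * T N + 1 + (S N x - 2 * T N)\<^sup>2" for x
        proof -
          have "0 \<le> (S N x - 2 * T N - 1)\<^sup>2 + (S N x - 2 * T N)\<^sup>2" by simp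
          then show ?thesis by (simp add: power2_eq_square algebra_simps)
        qed
      qed (use int in auto)
      also have "\<dots> = 2 * T N + 1 + expectation (\<lambda>x. (S N x - 2 * T N)\<^sup>2)"
        using int[of N] by (simp add: prob_space)
      also have "\<dots> \<le> 2 * B + 1 + C * (1 + B) * ln (2 + B) ^ 2"
      proof -
        have "C * (1 + T N) * ln (2 + T N) ^ 2 \<le> C * (1 + B) * ln (2 + B) ^ 2"
          using B[of N] T(4)[of N] C B0 by (intro mult_mono power_mono) auto
        then show ?thesis using var[of N] B[of N] by linarith
      qed
      finally show ?thesis by (simp add: D_def)
    qed
    then have "summable (\<lambda>t. prob (A (Suc t)))"
      by (intro summableI_nonneg_bounded[where x = D]) (auto simp: sum.atLeast1_atMost_eq)
    then have "AE x in M. eventually (\<lambda>t. x \<in> space M - A (Suc t)) sequentially"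
      by (intro borel_cantelli_AE1) (auto simp: emeasure_eq_measure)
    then show ?thesis
    proof eventually_elim
      case (elim x)
      then obtain t0 where t0: "\<And>t. t \<ge> t0 \<Longrightarrow> x \<notin> A (Suc t)" by (auto simp: eventually_sequentially)
      have S_t0: "S N x \<le> real t0" for N
      proof -
        have "S N x = (\<Sum>t<N. indicator (A (Suc t)) x)" by (simp add: S_def sum.atLeast1_atMost_eq)
        also have "\<dots> = (\<Sum>t\<in>{..<N} \<inter> {..<t0}. indicator (A (Suc t)) x)"
          using t0 by (intro sum.mono_neutral_right) (auto simp: indicator_def, meson not_le)
        also have "\<dots> \<le> (\<Sum>t\<in>{..<N} \<inter> {..<t0}. 1)" by (intro sum_mono) (auto simp: indicator_def)
        also have "\<dots> \<le> real t0" using card_mono[of "{..<t0}" "{..<N} \<inter> {..<t0}"] by simp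
        finally show ?thesis .
      qed
      have dev: "\<bar>S N x - 2 * T N\<bar> \<le> (real t0 + 2 * B) + 0 * error_scale (T N)" for N
      proof -
        have "\<bar>S N x - 2 * T N\<bar> \<le> real t0 + 2 * B"
          using S_nonneg[of N x] B[of N] T(4)[of N] S_t0[of N] by linarith
        then show ?thesis by simp
      qed
      show ?case
        by (rule absorb_constant_error[OF T(1,4), of "\<lambda>N. S N x", OF zero dev])
    qed
  next
    case False
    then have unb: "\<exists>N. B \<le> T N" for B by (meson linear)
    note ct = cube_time[OF T(2,3) unb]
    define E where "E = (\<lambda>j. {x \<in> space M. (real j ^ 2 * ln (real j) ^ 2)\<^sup>2
        \<le> (S (cube_time T j) x - 2 * T (cube_time T j))\<^sup>2})"
    have [measurable]: "E j \<in> events" for j unfolding E_def by measurable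
    have "prob (E j) \<le> 32 * C * (1 / (real j * ln (real j) ^ 2))" if "j \<ge> 3" for j
    proof -
      define l where "l = ln (real j)"
      have l: "l > 0" using that by (simp add: l_def)
      have b: "T (cube_time T j) \<le> real j ^ 3 + 1/2" using ct(2)[of j] that by simp
      have j9: "real j ^ 3 \<ge> 27" using that power_mono[of 3 "real j" 3] by simp
      have "real j ^ 4 = real j * real j ^ 3" by (simp add: eval_nat_numeral)
      then have j4: "3 * real j ^ 3 \<le> real j ^ 4"
        using that mult_right_mono[of 3 "real j" "real j ^ 3"] by simp
      have "ln (2 + T (cube_time T j)) \<le> ln (real j ^ 4)"
        using b j9 j4 T(4)[of "cube_time T j"] by (intro ln_mono) auto
      also have "\<dots> = 4 * l" using that by (simp add: l_def ln_realpow)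
      finally have ln4: "ln (2 + T (cube_time T j)) \<le> 4 * l" .
      have "prob (E j) \<le> expectation (\<lambda>x. (S (cube_time T j) x - 2 * T (cube_time T j))\<^sup>2) / (real j ^ 2 * l ^ 2)\<^sup>2"
        unfolding E_def l_def[symmetric] using that l
        by (intro integral_Markov_inequality_measure[where A = "space M"] int) auto
      also have "\<dots> \<le> (C * (2 * real j ^ 3) * (4 * l) ^ 2) / (real j ^ 2 * l ^ 2)\<^sup>2"
      proof (rule divide_right_mono)
        have "C * (1 + T (cube_time T j)) * ln (2 + T (cube_time T j)) ^ 2 \<le> C * (2 * real j ^ 3) * (4 * l) ^ 2"
          using b j9 ln4 T(4)[of "cube_time T j"] C by (intro mult_mono power_mono) auto
        then show "expectation (\<lambda>x. (S (cube_time T j) x - 2 * T (cube_time T j))\<^sup>2) \<le> C * (2 * real j ^ 3) * (4 * l) ^ 2"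
          using var order_trans by blast
      qed auto
      also have "\<dots> = 32 * C * (1 / (real j * l ^ 2))"
      proof -
        have "C * (2 * real j ^ 3) * (4 * l) ^ 2 = (real j ^ 3 * l ^ 2) * (32 * C)"
          by (simp add: power2_eq_square)
        moreover have "(real j ^ 2 * l ^ 2)\<^sup>2 = (real j ^ 3 * l ^ 2) * (real j * l ^ 2)"
          by (simp add: power2_eq_square power3_eq_cube)
        moreover have "real j ^ 3 * l ^ 2 \<noteq> 0" using l that by simp
        ultimately show ?thesis by (simp only: mult_divide_mult_cancel_left) simp
      qed
      finally show ?thesis by (simp add: l_def)
    qed
    then have "summable (\<lambda>j. prob (E j))"
      by (intro summable_comparison_test'[OF summable_mult[OF summable_inverse_n_ln_squared, of "32 * C"], of 3]) auto
    then have "AE x in M. eventually (\<lambda>j. x \<in> space M - E j) sequentially"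
      by (intro borel_cantelli_AE1) (auto simp: emeasure_eq_measure)
    then show ?thesis
    proof eventually_elim
      case (elim x)
      then obtain j0 where j0: "\<And>j. j \<ge> j0 \<Longrightarrow> x \<in> space M - E j" by (auto simp: eventually_sequentially)
      define J where "J = max 3 j0"
      have J: "\<bar>S (cube_time T j) x - 2 * T (cube_time T j)\<bar> \<le> real j ^ 2 * ln (real j) ^ 2" if "j \<ge> J" for j
      proof -
        have "(S (cube_time T j) x - 2 * T (cube_time T j))\<^sup>2 \<le> (real j ^ 2 * ln (real j) ^ 2)\<^sup>2"
          using j0[of j] that by (auto simp: E_def J_def)
        then show ?thesis by (simp add: abs_le_square_iff[symmetric])
      qed
      obtain N1 where N1: "real J ^ 3 \<le> T N1" using unb by blast
      have dev: "\<bar>S N x - 2 * T N\<bar> \<le> (real N1 + 2 * real J ^ 3) + 20 * error_scale (T N)" for N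
      proof (cases "real J ^ 3 \<le> T N")
        case True
        then have "\<bar>S N x - 2 * T N\<bar> \<le> 20 * error_scale (T N)"
          by (intro interpolate_between_cube_times[OF T(1-3) unb S_mono _ J]) (simp_all add: J_def)
        then show ?thesis by (simp add: add_increasing)
      next
        case False
        then have "\<not> N1 \<le> N" using N1 monoD[OF T(1), of N1 N] by linarith
        then have "S N x \<le> real N1" using S_le[of N x] by linarith
        then show ?thesis
          using False S_nonneg[of N x] T(4)[of N] error_scale_nonneg[OF T(4)[of N]] by linarith
      qed
      show ?case
        by (rule absorb_constant_error[OF T(1,4), of "\<lambda>N. S N x", OF zero dev])
    qed
  qed
qed

end

section \<open>Counting for decorrelated phases\<close>

lemma borel_measurable_dist_int[measurable]: "dist_int \<in> borel_measurable borel"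
  unfolding dist_int_def[abs_def] by (intro borel_measurable_continuous_onI continuous_intros)

lemma borel_measurable_trig_poly[measurable]: "trig_poly a K \<in> borel_measurable borel"
  unfolding trig_poly_def[abs_def] by measurable

lemma admissible_coeffs_constant_term:
  assumes "admissible_coeffs w \<delta> K a" "0 \<le> w" "\<delta> \<le> 1 / 2"
  shows "\<bar>a 0\<bar> \<le> 3 * w"
proof -
  have "\<delta> * w \<le> 1 / 2 * w" using assms by (intro mult_right_mono) auto
  then show ?thesis using assms by (auto simp: admissible_coeffs_def)
qed

text \<open>
Real random variables, regarded modulo \<open>1\<close>, that are nearly uniform and nearly independent in pairs:
their characters have small expectations, of size \<open>\<rho> t\<close> in general. The exception is one resonant
\<open>l\<close> for each \<open>k\<close> and each pair \<open>s < t\<close>, where the bound may be as weak as \<open>\<rho> s + \<rho> (t - s)\<close>.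
Summability of \<open>t \<rho>(t)\<close> makes the sum of \<open>\<rho> t\<close> over all pairs \<open>s < t\<close> finite.
\<close>

locale decorrelated_phases = prob_space +
  fixes X :: "nat \<Rightarrow> 'a \<Rightarrow> real" and \<rho> :: "nat \<Rightarrow> real"
  assumes X_measurable[measurable]: "\<And>t. X t \<in> borel_measurable M"
    and \<rho>_nonneg: "\<And>t. 0 \<le> \<rho> t"
    and \<rho>_summable: "summable (\<lambda>t. real t * \<rho> t)"
    and phase: "\<And>t k. 1 \<le> t \<Longrightarrow> 1 \<le> k \<Longrightarrow> \<bar>expectation (\<lambda>x. cos (2 * pi * real k * X t x))\<bar> \<le> \<rho> t"
    and phase_tendsto: "\<And>t. 1 \<le> t \<Longrightarrow> (\<lambda>k. expectation (\<lambda>x. cos (2 * pi * real k * X t x))) \<longlonglongrightarrow> 0"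
    and phase_sum: "\<And>s t k l. 1 \<le> s \<Longrightarrow> s < t \<Longrightarrow> 1 \<le> k \<Longrightarrow> 1 \<le> l \<Longrightarrow>
          \<bar>expectation (\<lambda>x. cos (2 * pi * real k * X s x + 2 * pi * real l * X t x))\<bar> \<le> \<rho> t"
    and phase_diff: "\<And>s t k. 1 \<le> s \<Longrightarrow> s < t \<Longrightarrow> 1 \<le> k \<Longrightarrow> \<exists>l0. \<forall>l\<ge>1.
          \<bar>expectation (\<lambda>x. cos (2 * pi * real k * X s x - 2 * pi * real l * X t x))\<bar>
            \<le> (if l = l0 then \<rho> s + \<rho> (t - s) else \<rho> t)"
begin

definition total :: real where "total = (\<Sum>t. real t * \<rho> t)"

lemma sum_weighted_le_total: "(\<Sum>t=1..N. real t * \<rho> t) \<le> total"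
  unfolding total_def using \<rho>_nonneg by (intro sum_le_suminf \<rho>_summable) auto

lemma total_nonneg: "0 \<le> total"
  using sum_weighted_le_total[of 0] by simp

lemma sum_le_total: "(\<Sum>t=1..N. \<rho> t) \<le> total"
proof -
  have "(\<Sum>t=1..N. \<rho> t) \<le> (\<Sum>t=1..N. real t * \<rho> t)"
  proof (rule sum_mono)
    fix t assume "t \<in> {1..N}"
    then show "\<rho> t \<le> real t * \<rho> t"
      using mult_right_mono[of 1 "real t" "\<rho> t"] \<rho>_nonneg[of t] by simp
  qed
  then show ?thesis using sum_weighted_le_total order_trans by blast
qed

lemma integrable_cos: "f \<in> borel_measurable M \<Longrightarrow> integrable M (\<lambda>x. cos (f x :: real))"
  by (rule integrable_const_bound[where B = 1]) auto

lemma integrable_trig_poly: "integrable M (\<lambda>x. trig_poly a K (X t x))"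
  unfolding trig_poly_def by (intro Bochner_Integration.integrable_add Bochner_Integration.integrable_sum integrable_mult_right integrable_cos) auto

lemma expectation_trig_poly:
  "expectation (\<lambda>x. trig_poly a K (X t x)) = a 0 + (\<Sum>k=1..K. a k * expectation (\<lambda>x. cos (2 * pi * real k * X t x)))"
proof -
  have i: "integrable M (\<lambda>x. a k * cos (2 * pi * real k * X t x))" for k
    by (intro integrable_mult_right integrable_cos) auto
  have "expectation (\<lambda>x. trig_poly a K (X t x)) = expectation (\<lambda>x. a 0) + expectation (\<lambda>x. \<Sum>k=1..K. a k * cos (2 * pi * real k * X t x))"
    unfolding trig_poly_def
    by (rule Bochner_Integration.integral_add) (auto intro!: Bochner_Integration.integrable_sum i)
  also have "expectation (\<lambda>x. \<Sum>k=1..K. a k * cos (2 * pi * real k * X t x)) = (\<Sum>k=1..K. expectation (\<lambda>x. a k * cos (2 * pi * real k * X t x)))"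
    by (rule Bochner_Integration.integral_sum) (rule i)
  finally show ?thesis by (simp add: prob_space)
qed

definition centred_cos :: "nat \<Rightarrow> nat \<Rightarrow> 'a \<Rightarrow> real" where
  "centred_cos t k x = cos (2 * pi * real k * X t x) - expectation (\<lambda>x. cos (2 * pi * real k * X t x))"

lemma centred_cos_measurable[measurable]: "centred_cos t k \<in> borel_measurable M"
  unfolding centred_cos_def[abs_def] by measurable

lemma abs_centred_cos_le: "\<bar>centred_cos t k x\<bar> \<le> 2"
proof -
  have "\<bar>expectation (\<lambda>x. cos (2 * pi * real k * X t x))\<bar> \<le> expectation (\<lambda>x. 1)"
    by (rule order_trans[OF integral_abs_bound]) (intro integral_mono, auto intro!: integrable_cos integrable_abs)
  then have "\<bar>expectation (\<lambda>x. cos (2 * pi * real k * X t x))\<bar> \<le> 1" by (simp add: prob_space)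
  moreover have "\<bar>cos (2 * pi * real k * X t x)\<bar> \<le> 1" by simp
  ultimately show ?thesis unfolding centred_cos_def by linarith
qed

lemma integrable_centred_cos_mult: "integrable M (\<lambda>x. centred_cos s k x * centred_cos t l x)"
proof (rule integrable_const_bound[where B = "2 * 2"])
  show "AE x in M. norm (centred_cos s k x * centred_cos t l x) \<le> 2 * 2"
    unfolding real_norm_def abs_mult
    by (intro always_eventually allI mult_mono abs_centred_cos_le) auto
qed measurable

text \<open>
The product of two cosines is the mean of the cosines of the sum and of the difference of their
arguments; only the difference can be resonant.
\<close>

lemma covariance_cos_bound:
  assumes "1 \<le> s" "s < t" "1 \<le> k"
  shows "\<exists>l0. \<forall>l\<ge>1. \<bar>expectation (\<lambda>x. centred_cos s k x * centred_cos t l x)\<bar>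
     \<le> 2 * \<rho> t + (if l = l0 then \<rho> s + \<rho> (t - s) else 0)"
proof -
  obtain l0 where l0: "\<And>l. l \<ge> 1 \<Longrightarrow> \<bar>expectation (\<lambda>x. cos (2 * pi * real k * X s x - 2 * pi * real l * X t x))\<bar>
            \<le> (if l = l0 then \<rho> s + \<rho> (t - s) else \<rho> t)"
    using phase_diff[OF assms] by blast
  have "\<bar>expectation (\<lambda>x. centred_cos s k x * centred_cos t l x)\<bar> \<le> 2 * \<rho> t + (if l = l0 then \<rho> s + \<rho> (t - s) else 0)"
    if "l \<ge> 1" for l
  proof -
    define U V where "U = (\<lambda>x. cos (2 * pi * real k * X s x))" and "V = (\<lambda>x. cos (2 * pi * real l * X t x))"
    have int: "integrable M U" "integrable M V" by (auto simp: U_def V_def intro!: integrable_cos)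
    have prod: "U x * V x = (cos (2 * pi * real k * X s x - 2 * pi * real l * X t x) +
        cos (2 * pi * real k * X s x + 2 * pi * real l * X t x)) / 2" for x
      by (simp add: U_def V_def cos_times_cos)
    have intUV: "integrable M (\<lambda>x. U x * V x)"
      unfolding prod by (intro integrable_divide Bochner_Integration.integrable_add integrable_cos) auto
    have EUV: "expectation (\<lambda>x. U x * V x) = (expectation (\<lambda>x. cos (2 * pi * real k * X s x - 2 * pi * real l * X t x)) +
        expectation (\<lambda>x. cos (2 * pi * real k * X s x + 2 * pi * real l * X t x))) / 2"
      unfolding prod by (simp add: integrable_cos)
    have "centred_cos s k = (\<lambda>x. U x - expectation U)" "centred_cos t l = (\<lambda>x. V x - expectation V)"
      by (auto simp: centred_cos_def U_def V_def)
    then have "expectation (\<lambda>x. centred_cos s k x * centred_cos t l x)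
        = expectation (\<lambda>x. U x * V x - expectation U * V x - expectation V * U x + expectation U * expectation V)"
      by (simp add: algebra_simps)
    also have "\<dots> = expectation (\<lambda>x. U x * V x) - expectation U * expectation V"
      using int intUV by (simp add: prob_space)
    finally have eq: "expectation (\<lambda>x. centred_cos s k x * centred_cos t l x) = expectation (\<lambda>x. U x * V x) - expectation U * expectation V" .
    have "\<bar>expectation U\<bar> \<le> expectation (\<lambda>x. 1)"
      using int by (intro order_trans[OF integral_abs_bound] integral_mono) (auto simp: U_def)
    then have "\<bar>expectation U * expectation V\<bar> \<le> 1 * \<rho> t"
      using phase[of t l] that assms unfolding abs_mult V_def by (intro mult_mono) (auto simp: prob_space)
    moreover have "\<bar>expectation (\<lambda>x. U x * V x)\<bar> \<le> ((if l = l0 then \<rho> s + \<rho> (t - s) else \<rho> t) + \<rho> t) / 2"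
      unfolding EUV using l0[OF that] phase_sum[OF assms that] by (simp add: abs_le_iff)
    ultimately show ?thesis
      unfolding eq using \<rho>_nonneg[of s] \<rho>_nonneg[of t] \<rho>_nonneg[of "t-s"] by (auto split: if_splits)
  qed
  then show ?thesis by blast
qed

definition centred_poly :: "(nat \<Rightarrow> real) \<Rightarrow> nat \<Rightarrow> nat \<Rightarrow> 'a \<Rightarrow> real" where
  "centred_poly a K t x = trig_poly a K (X t x) - expectation (\<lambda>x. trig_poly a K (X t x))"

lemma centred_poly_eq: "centred_poly a K t x = (\<Sum>k=1..K. a k * centred_cos t k x)"
  unfolding centred_poly_def expectation_trig_poly unfolding trig_poly_def centred_cos_def
  by (simp add: sum_subtractf right_diff_distrib)

lemma integrable_centred_poly_mult: "integrable M (\<lambda>x. centred_poly a K s x * centred_poly b L t x)"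
  unfolding centred_poly_eq sum_product
  by (intro Bochner_Integration.integrable_sum)
     (simp add: mult.assoc mult.left_commute[of _ "b _"] integrable_centred_cos_mult)

text \<open>
Non-resonant pairs cost the product of both \<open>\<ell>\<^sup>1\<close> norms. For every \<open>k\<close> at most one \<open>l\<close> is resonant, so
the resonant pairs cost only one \<open>\<ell>\<^sup>1\<close> norm times the largest coefficient of the other polynomial.
This saving keeps their total, up to the \<open>\<ell>\<^sup>1\<close> norm, of the order of the expected count.
\<close>

lemma covariance_trig_poly_bound:
  assumes "1 \<le> s" "s < t" and b: "\<And>l. l \<in> {1..L} \<Longrightarrow> \<bar>b l\<bar> \<le> \<beta>" "0 \<le> \<beta>"
  shows "\<bar>expectation (\<lambda>x. centred_poly a K s x * centred_poly b L t x)\<bar>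
    \<le> 2 * \<rho> t * (\<Sum>k=1..K. \<bar>a k\<bar>) * (\<Sum>l=1..L. \<bar>b l\<bar>) + (\<Sum>k=1..K. \<bar>a k\<bar>) * \<beta> * (\<rho> s + \<rho> (t - s))"
proof -
  define c where "c = (\<lambda>k l. expectation (\<lambda>x. centred_cos s k x * centred_cos t l x))"
  have int: "integrable M (\<lambda>x. a k * centred_cos s k x * (b l * centred_cos t l x))" for k l
    by (simp add: mult.assoc mult.left_commute[of _ "b _"] integrable_centred_cos_mult)
  have "expectation (\<lambda>x. centred_poly a K s x * centred_poly b L t x) = (\<Sum>k=1..K. \<Sum>l=1..L. a k * b l * c k l)"
    unfolding centred_poly_eq sum_product
    by (subst Bochner_Integration.integral_sum, intro Bochner_Integration.integrable_sum int,
        subst Bochner_Integration.integral_sum, rule int)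
       (simp add: c_def mult.assoc mult.left_commute[of _ "b _"])
  also have "\<bar>\<dots>\<bar> \<le> (\<Sum>k=1..K. \<bar>\<Sum>l=1..L. a k * b l * c k l\<bar>)" by (rule sum_abs)
  also have "\<dots> \<le> (\<Sum>k=1..K. \<bar>a k\<bar> * (2 * \<rho> t * (\<Sum>l=1..L. \<bar>b l\<bar>) + \<beta> * (\<rho> s + \<rho> (t - s))))"
  proof (rule sum_mono)
    fix k assume k: "k \<in> {1..K}"
    obtain l0 where l0: "\<And>l. l \<ge> 1 \<Longrightarrow> \<bar>c k l\<bar> \<le> 2 * \<rho> t + (if l = l0 then \<rho> s + \<rho> (t - s) else 0)"
      using covariance_cos_bound[of s t k] assms k by (auto simp: c_def)
    have "\<bar>\<Sum>l=1..L. a k * b l * c k l\<bar> \<le> (\<Sum>l=1..L. \<bar>a k * b l * c k l\<bar>)" by (rule sum_abs)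
    also have "\<dots> \<le> (\<Sum>l=1..L. \<bar>a k\<bar> * (\<bar>b l\<bar> * (2 * \<rho> t) + (if l = l0 then \<beta> * (\<rho> s + \<rho> (t - s)) else 0)))"
    proof (rule sum_mono)
      fix l assume l: "l \<in> {1..L}"
      have "\<bar>b l\<bar> * \<bar>c k l\<bar> \<le> \<bar>b l\<bar> * (2 * \<rho> t + (if l = l0 then \<rho> s + \<rho> (t - s) else 0))"
        using l0[of l] l by (intro mult_left_mono) auto
      also have "\<dots> \<le> \<bar>b l\<bar> * (2 * \<rho> t) + (if l = l0 then \<beta> * (\<rho> s + \<rho> (t - s)) else 0)"
        using b(1)[OF l] \<rho>_nonneg[of s] \<rho>_nonneg[of "t - s"] by (auto simp: distrib_left intro!: add_mono mult_right_mono)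
      finally show "\<bar>a k * b l * c k l\<bar> \<le> \<bar>a k\<bar> * (\<bar>b l\<bar> * (2 * \<rho> t) + (if l = l0 then \<beta> * (\<rho> s + \<rho> (t - s)) else 0))"
        unfolding abs_mult mult.assoc by (intro mult_left_mono) auto
    qed
    also have "\<dots> = \<bar>a k\<bar> * (2 * \<rho> t * (\<Sum>l=1..L. \<bar>b l\<bar>) + (\<Sum>l=1..L. if l = l0 then \<beta> * (\<rho> s + \<rho> (t - s)) else 0))"
      by (simp add: sum_distrib_left[symmetric] sum_distrib_right[symmetric] sum.distrib mult.commute)
    also have "\<dots> \<le> \<bar>a k\<bar> * (2 * \<rho> t * (\<Sum>l=1..L. \<bar>b l\<bar>) + \<beta> * (\<rho> s + \<rho> (t - s)))"
      using b(2) \<rho>_nonneg[of s] \<rho>_nonneg[of "t - s"] by (intro mult_left_mono add_left_mono) auto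
    finally show "\<bar>\<Sum>l=1..L. a k * b l * c k l\<bar> \<le> \<bar>a k\<bar> * (2 * \<rho> t * (\<Sum>l=1..L. \<bar>b l\<bar>) + \<beta> * (\<rho> s + \<rho> (t - s)))" .
  qed
  also have "\<dots> = 2 * \<rho> t * (\<Sum>k=1..K. \<bar>a k\<bar>) * (\<Sum>l=1..L. \<bar>b l\<bar>) + (\<Sum>k=1..K. \<bar>a k\<bar>) * \<beta> * (\<rho> s + \<rho> (t - s))"
    unfolding sum_distrib_right[symmetric] by (simp add: algebra_simps)
  finally show ?thesis .
qed

lemma expectation_trig_poly_near:
  assumes "1 \<le> t"
  shows "\<bar>expectation (\<lambda>x. trig_poly a K (X t x)) - a 0\<bar> \<le> (\<Sum>k=1..K. \<bar>a k\<bar>) * \<rho> t"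
proof -
  have "\<bar>expectation (\<lambda>x. trig_poly a K (X t x)) - a 0\<bar> = \<bar>\<Sum>k=1..K. a k * expectation (\<lambda>x. cos (2 * pi * real k * X t x))\<bar>"
    by (simp add: expectation_trig_poly)
  also have "\<dots> \<le> (\<Sum>k=1..K. \<bar>a k * expectation (\<lambda>x. cos (2 * pi * real k * X t x))\<bar>)" by (rule sum_abs)
  also have "\<dots> \<le> (\<Sum>k=1..K. \<bar>a k\<bar> * \<rho> t)"
    unfolding abs_mult using phase[OF assms] by (intro sum_mono mult_left_mono) auto
  finally show ?thesis by (simp add: sum_distrib_right)
qed

lemma expectation_centred_square:
  assumes adm: "admissible_coeffs w \<delta> K a" and "0 \<le> w" "\<delta> \<le> 1 / 2" "1 \<le> t"
  shows "expectation (\<lambda>x. centred_poly a K t x * centred_poly a K t x) \<le> 14 * w + 2 * (16 * ln (4 / \<delta>)) * \<rho> t"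
proof -
  define p where "p = (\<lambda>x. trig_poly a K (X t x))"
  define m where "m = expectation p"
  have p: "integrable M p" unfolding p_def by (rule integrable_trig_poly)
  have cp: "p x = centred_poly a K t x + m" for x by (simp add: centred_poly_def p_def m_def)
  have "integrable M (\<lambda>x. p x * p x)"
    unfolding cp using integrable_centred_poly_mult[of a K t a K t] p cp
    by (simp add: distrib_left distrib_right, intro Bochner_Integration.integrable_add)
       (auto simp: centred_poly_def p_def[symmetric] m_def[symmetric] intro!: p)
  have "expectation (\<lambda>x. centred_poly a K t x * centred_poly a K t x) \<le> expectation (\<lambda>x. p x * p x)"
  proof -
    have "centred_poly a K t x * centred_poly a K t x = p x * p x - 2 * m * p x + m * m" for x
      by (simp add: cp algebra_simps)
    then have "expectation (\<lambda>x. centred_poly a K t x * centred_poly a K t x) = expectation (\<lambda>x. p x * p x) - 2 * m * m + m * m"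
      using p \<open>integrable M (\<lambda>x. p x * p x)\<close> by (simp add: prob_space m_def)
    then show ?thesis using zero_le_square[of m] by linarith
  qed
  also have "\<dots> \<le> expectation (\<lambda>x. 2 * p x + 8 * w)"
    using p \<open>integrable M (\<lambda>x. p x * p x)\<close> adm
    by (intro integral_mono) (auto simp: admissible_coeffs_def p_def power2_eq_square)
  also have "\<dots> = 2 * m + 8 * w" using p by (simp add: prob_space m_def)
  also have "m \<le> \<bar>a 0\<bar> + (\<Sum>k=1..K. \<bar>a k\<bar>) * \<rho> t"
    using expectation_trig_poly_near[OF assms(4), of a K] by (simp add: m_def p_def)
  also have "(\<Sum>k=1..K. \<bar>a k\<bar>) * \<rho> t \<le> 16 * ln (4 / \<delta>) * \<rho> t"
    using adm \<rho>_nonneg by (intro mult_right_mono) (auto simp: admissible_coeffs_def)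
  also have "\<bar>a 0\<bar> \<le> 3 * w" using admissible_coeffs_constant_term[OF adm] assms by blast
  finally show ?thesis by simp
qed

text \<open>
Induction on \<open>N\<close>: a new summand adds its own variance and its covariances with the earlier ones.
Summed over \<open>s\<close>, the non-resonant bound gives \<open>t \<rho>(t)\<close> and the resonant one gives at most
\<open>2 * total\<close>.
\<close>

lemma second_moment_centred_sum:
  assumes \<delta>: "0 < \<delta>" "\<delta> \<le> 1 / 2" and w: "\<And>t. 1 \<le> t \<Longrightarrow> 0 \<le> w t"
    and adm: "\<And>t. 1 \<le> t \<Longrightarrow> admissible_coeffs (w t) \<delta> (K t) (a t)"
  defines "L \<equiv> 16 * ln (4 / \<delta>)"
  shows "integrable M (\<lambda>x. (\<Sum>t=1..N. centred_poly (a t) (K t) t x)\<^sup>2)" (is ?int)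
    and "expectation (\<lambda>x. (\<Sum>t=1..N. centred_poly (a t) (K t) t x)\<^sup>2)
      \<le> 14 * (\<Sum>t=1..N. w t) + 2 * L * total + 4 * L\<^sup>2 * total + 32 * L * total * (\<Sum>t=1..N. w t)" (is ?bound)
proof -
  define W where "W = (\<lambda>t. centred_poly (a t) (K t) t)"
  define S where "S = (\<lambda>N x. \<Sum>t=1..N. W t x)"
  define v where "v = (\<lambda>t. 14 * w t + 2 * L * \<rho> t + 4 * L\<^sup>2 * (real t * \<rho> t) + 32 * L * total * w t)"
  have L: "0 \<le> L" using \<delta> by (simp add: L_def)
  have intW: "integrable M (\<lambda>x. W s x * W t x)" for s t
    unfolding W_def by (rule integrable_centred_poly_mult)
  have int_SW: "integrable M (\<lambda>x. S N x * W t x)" for N t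
    unfolding S_def sum_distrib_right by (intro Bochner_Integration.integrable_sum intW)
  have int_SS: "integrable M (\<lambda>x. (S N x)\<^sup>2)" for N
    unfolding S_def power2_eq_square sum_product by (intro Bochner_Integration.integrable_sum intW)
  then show ?int unfolding S_def W_def .
  have l1: "(\<Sum>k=1..K t. \<bar>a t k\<bar>) \<le> L" "0 \<le> (\<Sum>k=1..K t. \<bar>a t k\<bar>)" if "1 \<le> t" for t
    using adm[OF that] by (auto simp: admissible_coeffs_def L_def intro!: sum_nonneg)
  have cross: "\<bar>expectation (\<lambda>x. S N x * W (Suc N) x)\<bar> \<le> 2 * L\<^sup>2 * (real (Suc N) * \<rho> (Suc N)) + 16 * L * total * w (Suc N)" for N
  proof -
    let ?t = "Suc N"
    have w0: "0 \<le> w ?t" by (rule w) simp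
    have "expectation (\<lambda>x. S N x * W ?t x) = (\<Sum>s=1..N. expectation (\<lambda>x. W s x * W ?t x))"
      unfolding S_def sum_distrib_right by (rule Bochner_Integration.integral_sum) (rule intW)
    also have "\<bar>\<dots>\<bar> \<le> (\<Sum>s=1..N. \<bar>expectation (\<lambda>x. W s x * W ?t x)\<bar>)" by (rule sum_abs)
    also have "\<dots> \<le> (\<Sum>s=1..N. 2 * \<rho> ?t * L\<^sup>2 + L * (8 * w ?t) * (\<rho> s + \<rho> (?t - s)))"
    proof (rule sum_mono)
      fix s assume s: "s \<in> {1..N}"
      have "\<bar>expectation (\<lambda>x. W s x * W ?t x)\<bar> \<le> 2 * \<rho> ?t * (\<Sum>k=1..K s. \<bar>a s k\<bar>) * (\<Sum>l=1..K ?t. \<bar>a ?t l\<bar>)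
          + (\<Sum>k=1..K s. \<bar>a s k\<bar>) * (8 * w ?t) * (\<rho> s + \<rho> (?t - s))"
        unfolding W_def using s adm[of ?t] w0
        by (intro covariance_trig_poly_bound) (auto simp: admissible_coeffs_def)
      also have "\<dots> \<le> 2 * \<rho> ?t * L * L + L * (8 * w ?t) * (\<rho> s + \<rho> (?t - s))"
        using s l1[of s] l1[of ?t] L w0 \<rho>_nonneg[of s] \<rho>_nonneg[of ?t] \<rho>_nonneg[of "?t - s"]
        by (intro add_mono mult_mono) auto
      finally show "\<bar>expectation (\<lambda>x. W s x * W ?t x)\<bar> \<le> 2 * \<rho> ?t * L\<^sup>2 + L * (8 * w ?t) * (\<rho> s + \<rho> (?t - s))"
        by (simp add: power2_eq_square mult.assoc)
    qed
    also have "\<dots> = real N * (2 * \<rho> ?t * L\<^sup>2) + L * (8 * w ?t) * ((\<Sum>s=1..N. \<rho> s) + (\<Sum>s=1..N. \<rho> (?t - s)))"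
      by (simp add: sum.distrib sum_distrib_left[symmetric])
    also have "(\<Sum>s=1..N. \<rho> (?t - s)) = (\<Sum>s=1..N. \<rho> s)"
      using sum.atLeastAtMost_rev[of \<rho> 1 N] by simp
    also have "real N * (2 * \<rho> ?t * L\<^sup>2) + L * (8 * w ?t) * ((\<Sum>s=1..N. \<rho> s) + (\<Sum>s=1..N. \<rho> s))
        \<le> real ?t * (2 * \<rho> ?t * L\<^sup>2) + L * (8 * w ?t) * (total + total)"
      using \<rho>_nonneg[of ?t] L w0 sum_le_total[of N] by (intro add_mono mult_right_mono mult_left_mono) auto
    also have "\<dots> = 2 * L\<^sup>2 * (real ?t * \<rho> ?t) + 16 * L * total * w ?t" by (simp add: algebra_simps)
    finally show ?thesis .
  qed
  have "expectation (\<lambda>x. (S N x)\<^sup>2) \<le> (\<Sum>t=1..N. v t)"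
  proof (induction N)
    case 0
    then show ?case by (simp add: S_def)
  next
    case (Suc N)
    have "(S (Suc N) x)\<^sup>2 = (S N x)\<^sup>2 + 2 * (S N x * W (Suc N) x) + W (Suc N) x * W (Suc N) x" for x
      by (simp add: S_def power2_eq_square algebra_simps)
    then have "expectation (\<lambda>x. (S (Suc N) x)\<^sup>2) = expectation (\<lambda>x. (S N x)\<^sup>2) + 2 * expectation (\<lambda>x. S N x * W (Suc N) x)
        + expectation (\<lambda>x. W (Suc N) x * W (Suc N) x)"
      using int_SS int_SW intW by simp
    moreover have "expectation (\<lambda>x. W (Suc N) x * W (Suc N) x) \<le> 14 * w (Suc N) + 2 * L * \<rho> (Suc N)"
      unfolding W_def L_def by (rule expectation_centred_square[OF adm w \<delta>(2)]) auto
    ultimately have "expectation (\<lambda>x. (S (Suc N) x)\<^sup>2) \<le> (\<Sum>t=1..N. v t) + v (Suc N)"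
      using Suc.IH cross[of N] unfolding v_def by linarith
    then show ?case by simp
  qed
  also have "(\<Sum>t=1..N. v t) = 14 * (\<Sum>t=1..N. w t) + 2 * L * (\<Sum>t=1..N. \<rho> t) + 4 * L\<^sup>2 * (\<Sum>t=1..N. real t * \<rho> t)
      + 32 * L * total * (\<Sum>t=1..N. w t)"
    unfolding v_def by (simp add: sum.distrib sum_distrib_left)
  also have "\<dots> \<le> 14 * (\<Sum>t=1..N. w t) + 2 * L * total + 4 * L\<^sup>2 * total + 32 * L * total * (\<Sum>t=1..N. w t)"
    using L total_nonneg sum_le_total[of N] sum_weighted_le_total[of N] by (intro add_mono mult_left_mono) auto
  finally show ?bound unfolding S_def W_def .
qed

lemma second_moment_trig_sum:
  fixes w :: "nat \<Rightarrow> real" and N :: nat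
  assumes \<delta>: "0 < \<delta>" "\<delta> \<le> 1 / 2" and w: "\<And>t. 1 \<le> t \<Longrightarrow> 0 \<le> w t"
    and adm: "\<And>t. 1 \<le> t \<Longrightarrow> admissible_coeffs (w t) \<delta> (K t) (a t)"
  defines "L \<equiv> 16 * ln (4 / \<delta>)" and "T \<equiv> \<Sum>t=1..N. w t"
  shows "integrable M (\<lambda>x. ((\<Sum>t=1..N. trig_poly (a t) (K t) (X t x)) - 2 * T)\<^sup>2)" (is ?int)
    and "expectation (\<lambda>x. ((\<Sum>t=1..N. trig_poly (a t) (K t) (X t x)) - 2 * T)\<^sup>2)
      \<le> 2 * (14 * T + 2 * L * total + 4 * L\<^sup>2 * total + 32 * L * total * T) + 2 * (2 * \<delta> * T + L * total)\<^sup>2" (is ?bound)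
proof -
  define S where "S = (\<lambda>x. \<Sum>t=1..N. centred_poly (a t) (K t) t x)"
  define m where "m = (\<Sum>t=1..N. expectation (\<lambda>x. trig_poly (a t) (K t) (X t x))) - 2 * T"
  have eq: "(\<Sum>t=1..N. trig_poly (a t) (K t) (X t x)) - 2 * T = S x + m" for x
    by (simp add: S_def m_def centred_poly_def sum_subtractf)
  have intS: "integrable M (\<lambda>x. (S x)\<^sup>2)"
    unfolding S_def by (rule second_moment_centred_sum(1)[OF \<delta> w adm])
  have int1: "integrable M S"
    unfolding S_def centred_poly_def
    by (intro Bochner_Integration.integrable_sum Bochner_Integration.integrable_diff integrable_trig_poly) auto
  have sq: "(S x + m)\<^sup>2 = (S x)\<^sup>2 + 2 * m * S x + m\<^sup>2" for x by (simp add: power2_eq_square algebra_simps)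
  show int: ?int unfolding eq sq using intS int1 by simp
  have "expectation (\<lambda>x. ((\<Sum>t=1..N. trig_poly (a t) (K t) (X t x)) - 2 * T)\<^sup>2) \<le> expectation (\<lambda>x. 2 * (S x)\<^sup>2 + 2 * m\<^sup>2)"
  proof (rule integral_mono[OF int])
    show "integrable M (\<lambda>x. 2 * (S x)\<^sup>2 + 2 * m\<^sup>2)" using intS by simp
    show "((\<Sum>t=1..N. trig_poly (a t) (K t) (X t x)) - 2 * T)\<^sup>2 \<le> 2 * (S x)\<^sup>2 + 2 * m\<^sup>2" for x
      unfolding eq using zero_le_power2[of "S x - m"] by (simp add: power2_eq_square algebra_simps)
  qed
  also have "\<dots> = 2 * expectation (\<lambda>x. (S x)\<^sup>2) + 2 * m\<^sup>2" using intS by (simp add: prob_space)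
  also have "expectation (\<lambda>x. (S x)\<^sup>2) \<le> 14 * T + 2 * L * total + 4 * L\<^sup>2 * total + 32 * L * total * T"
    unfolding S_def L_def T_def by (rule second_moment_centred_sum(2)[OF \<delta> w adm])
  also have "m\<^sup>2 \<le> (2 * \<delta> * T + L * total)\<^sup>2"
  proof -
    have "m = (\<Sum>t=1..N. expectation (\<lambda>x. trig_poly (a t) (K t) (X t x)) - 2 * w t)"
      by (simp add: m_def T_def sum_subtractf sum_distrib_left)
    also have "\<bar>\<dots>\<bar> \<le> (\<Sum>t=1..N. \<bar>expectation (\<lambda>x. trig_poly (a t) (K t) (X t x)) - 2 * w t\<bar>)" by (rule sum_abs)
    also have "\<dots> \<le> (\<Sum>t=1..N. 2 * \<delta> * w t + L * \<rho> t)"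
    proof (rule sum_mono)
      fix t assume t: "t \<in> {1..N}"
      have "(\<Sum>k=1..K t. \<bar>a t k\<bar>) * \<rho> t \<le> L * \<rho> t"
        using adm[of t] t \<rho>_nonneg[of t] by (intro mult_right_mono) (auto simp: admissible_coeffs_def L_def)
      moreover have "\<bar>a t 0 - 2 * w t\<bar> \<le> 2 * \<delta> * w t" using adm[of t] t by (auto simp: admissible_coeffs_def)
      ultimately show "\<bar>expectation (\<lambda>x. trig_poly (a t) (K t) (X t x)) - 2 * w t\<bar> \<le> 2 * \<delta> * w t + L * \<rho> t"
        using expectation_trig_poly_near[of t "a t" "K t"] t by simp
    qed
    also have "\<dots> = 2 * \<delta> * T + L * (\<Sum>t=1..N. \<rho> t)" by (simp add: sum.distrib T_def sum_distrib_left)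
    also have "\<dots> \<le> 2 * \<delta> * T + L * total"
      using sum_le_total[of N] \<delta> by (intro add_left_mono mult_left_mono) (auto simp: L_def)
    finally show ?thesis by (rule power2_le_iff_abs_le[THEN iffD2, rotated]) (use \<delta> w total_nonneg in \<open>auto simp: T_def L_def intro!: add_nonneg_nonneg sum_nonneg mult_nonneg_nonneg\<close>)
  qed
  finally show ?bound by simp
qed

text \<open>
The condition \<open>w t > 0\<close> makes the event empty when the target is a single point, in accordance with
the majorants. Such targets are hit with probability zero by \<open>phase_not_integer\<close>.
\<close>

definition hit :: "(nat \<Rightarrow> real) \<Rightarrow> nat \<Rightarrow> 'a set" where
  "hit w t = {x \<in> space M. w t > 0 \<and> dist_int (X t x) \<le> w t}"

lemma hit_event[measurable]: "hit w t \<in> events"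
  unfolding hit_def by measurable

text \<open>
The count lies between the sums of the majorants and of the minorants, so its squared deviation is
at most the sum of theirs. The choice \<open>\<delta> = 1/(2 + T)\<close> makes the bias \<open>\<delta>T\<close> bounded and keeps the
\<open>\<ell>\<^sup>1\<close> norms logarithmic in \<open>T\<close>.
\<close>

lemma variance_of_hits:
  assumes w: "\<And>t. 1 \<le> t \<Longrightarrow> 0 \<le> w t" "\<And>t. 1 \<le> t \<Longrightarrow> w t \<le> 1 / 2"
  shows "\<exists>C\<ge>0. \<forall>N. expectation (\<lambda>x. ((\<Sum>t=1..N. indicator (hit w t) x) - 2 * (\<Sum>t=1..N. w t))\<^sup>2)
      \<le> C * (1 + (\<Sum>t=1..N. w t)) * ln (2 + (\<Sum>t=1..N. w t)) ^ 2"
proof -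
  define C where "C = 2 * (176 + 4 * 96 * total + 8 * 2304 * total + 64 * 96 * total + 4 * 2304 * total\<^sup>2)"
  have "expectation (\<lambda>x. ((\<Sum>t=1..N. indicator (hit w t) x) - 2 * (\<Sum>t=1..N. w t))\<^sup>2)
      \<le> C * (1 + (\<Sum>t=1..N. w t)) * ln (2 + (\<Sum>t=1..N. w t)) ^ 2" for N
  proof -
    define T where "T = (\<Sum>t=1..N. w t)"
    define \<delta> where "\<delta> = 1 / (2 + T)"
    define L where "L = 16 * ln (4 / \<delta>)"
    define l where "l = ln (2 + T)"
    have T: "0 \<le> T" using w by (auto simp: T_def intro!: sum_nonneg)
    have \<delta>: "0 < \<delta>" "\<delta> \<le> 1 / 2" using T by (auto simp: \<delta>_def field_simps)
    define B where "B = 2 * (14 * T + 2 * L * total + 4 * L\<^sup>2 * total + 32 * L * total * T) + 2 * (2 * \<delta> * T + L * total)\<^sup>2"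
    have "\<forall>t. \<exists>K a. 1 \<le> t \<longrightarrow> admissible_coeffs (w t) \<delta> K a \<and> (\<forall>x. of_bool (w t > 0 \<and> dist_int x \<le> w t) \<le> trig_poly a K x)"
      using trig_majorant[OF w \<delta>] by blast
    then obtain K a where up: "\<And>t. 1 \<le> t \<Longrightarrow> admissible_coeffs (w t) \<delta> (K t) (a t)"
      "\<And>t x. 1 \<le> t \<Longrightarrow> of_bool (w t > 0 \<and> dist_int x \<le> w t) \<le> trig_poly (a t) (K t) x"
      by metis
    have "\<forall>t. \<exists>K a. 1 \<le> t \<longrightarrow> admissible_coeffs (w t) \<delta> K a \<and> (\<forall>x. trig_poly a K x \<le> of_bool (w t > 0 \<and> dist_int x \<le> w t))"
      using trig_minorant[OF w \<delta>] by blast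
    then obtain K' a' where low: "\<And>t. 1 \<le> t \<Longrightarrow> admissible_coeffs (w t) \<delta> (K' t) (a' t)"
      "\<And>t x. 1 \<le> t \<Longrightarrow> trig_poly (a' t) (K' t) x \<le> of_bool (w t > 0 \<and> dist_int x \<le> w t)"
      by metis
    define U V H where "U = (\<lambda>x. \<Sum>t=1..N. trig_poly (a t) (K t) (X t x))"
      and "V = (\<lambda>x. \<Sum>t=1..N. trig_poly (a' t) (K' t) (X t x))"
      and "H = (\<lambda>x. \<Sum>t=1..N. indicator (hit w t) x :: real)"
    have U: "integrable M (\<lambda>x. (U x - 2 * T)\<^sup>2)" "expectation (\<lambda>x. (U x - 2 * T)\<^sup>2) \<le> B"
      unfolding U_def T_def B_def L_def by (rule second_moment_trig_sum[OF \<delta> w(1) up(1)]; simp)+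
    have V: "integrable M (\<lambda>x. (V x - 2 * T)\<^sup>2)" "expectation (\<lambda>x. (V x - 2 * T)\<^sup>2) \<le> B"
      unfolding V_def T_def B_def L_def by (rule second_moment_trig_sum[OF \<delta> w(1) low(1)]; simp)+
    have HUV: "V x \<le> H x" "H x \<le> U x" if "x \<in> space M" for x
    proof -
      have ind: "indicator (hit w t) x = (of_bool (w t > 0 \<and> dist_int (X t x) \<le> w t) :: real)" for t
        using that by (simp add: hit_def indicator_def)
      show "V x \<le> H x" unfolding H_def V_def ind by (intro sum_mono low(2)) auto
      show "H x \<le> U x" unfolding H_def U_def ind by (intro sum_mono up(2)) auto
    qed
    have sq: "(H x - 2 * T)\<^sup>2 \<le> (U x - 2 * T)\<^sup>2 + (V x - 2 * T)\<^sup>2" if "x \<in> space M" for x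
    proof (cases "H x \<ge> 2 * T")
      case True
      then have "(H x - 2 * T)\<^sup>2 \<le> (U x - 2 * T)\<^sup>2" using HUV[OF that] by (intro power_mono) auto
      then show ?thesis by (simp add: add_increasing2)
    next
      case False
      then have "(2 * T - H x)\<^sup>2 \<le> (2 * T - V x)\<^sup>2" using HUV[OF that] by (intro power_mono) auto
      then show ?thesis by (simp add: add_increasing power2_commute)
    qed
    have "expectation (\<lambda>x. (H x - 2 * T)\<^sup>2) \<le> expectation (\<lambda>x. (U x - 2 * T)\<^sup>2 + (V x - 2 * T)\<^sup>2)"
    proof (rule integral_mono)
      show i: "integrable M (\<lambda>x. (U x - 2 * T)\<^sup>2 + (V x - 2 * T)\<^sup>2)" using U V by simp
      show "integrable M (\<lambda>x. (H x - 2 * T)\<^sup>2)"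
      proof (rule Bochner_Integration.integrable_bound[OF i])
        show "(\<lambda>x. (H x - 2 * T)\<^sup>2) \<in> borel_measurable M" unfolding H_def by measurable
        show "AE x in M. norm ((H x - 2 * T)\<^sup>2) \<le> norm ((U x - 2 * T)\<^sup>2 + (V x - 2 * T)\<^sup>2)"
          using sq by auto
      qed
    qed (rule sq)
    also have "\<dots> \<le> 2 * B" using U V by simp
    also have "2 * B \<le> C * (1 + T) * l\<^sup>2"
    proof -
      have l: "1 / 2 \<le> l"
      proof -
        have "1 / 2 \<le> ln (2::real)" using ln_le_minus_one[of "1/2::real"] by (simp add: ln_div)
        also have "ln 2 \<le> l" using T by (simp add: l_def)
        finally show ?thesis by simp
      qed
      have Ll: "0 \<le> L" "L \<le> 48 * l"
      proof -
        show "0 \<le> L" using \<delta> by (simp add: L_def)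
        have "4 / \<delta> \<le> (2 + T) ^ 3"
        proof -
          have "2 * 2 \<le> (2 + T) * (2 + T)" using T by (intro mult_mono) auto
          then have "4 * (2 + T) \<le> ((2 + T) * (2 + T)) * (2 + T)" using T by (intro mult_right_mono) auto
          then show ?thesis by (simp add: \<delta>_def power3_eq_cube)
        qed
        then have "ln (4 / \<delta>) \<le> ln ((2 + T) ^ 3)" using \<delta> T by (intro ln_mono) auto
        also have "\<dots> = 3 * l" using T by (simp add: l_def ln_realpow)
        finally show "L \<le> 48 * l" by (simp add: L_def)
      qed
      have l2: "1 \<le> 4 * l\<^sup>2" "l \<le> 2 * l\<^sup>2"
        using l mult_mono[of "1/2" l "1/2" l] mult_right_mono[of "1/2" l l] by (auto simp: power2_eq_square)
      have LL: "L\<^sup>2 \<le> 2304 * l\<^sup>2" using power_mono[OF Ll(2,1), of 2] by (simp add: power_mult_distrib)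
      have L1: "L \<le> 96 * l\<^sup>2" using Ll l2 by linarith
      have dT: "\<delta> * T \<le> 1" "0 \<le> \<delta> * T" using T by (auto simp: \<delta>_def field_simps)
      have "(2 * \<delta> * T + L * total)\<^sup>2 \<le> 2 * (2 * \<delta> * T)\<^sup>2 + 2 * (L * total)\<^sup>2"
        using zero_le_power2[of "2 * \<delta> * T - L * total"] by (simp add: power2_eq_square algebra_simps)
      also have "(2 * \<delta> * T)\<^sup>2 \<le> 2\<^sup>2" unfolding mult.assoc using dT by (intro power_mono) auto
      finally have mean: "(2 * \<delta> * T + L * total)\<^sup>2 \<le> 8 + 2 * (L\<^sup>2 * total\<^sup>2)" by (simp add: power_mult_distrib)
      define y where "y = (1 + T) * l\<^sup>2"
      have y: "l\<^sup>2 \<le> y" "T * l\<^sup>2 \<le> y" "1 + T \<le> 4 * y"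
      proof -
        show "l\<^sup>2 \<le> y" "T * l\<^sup>2 \<le> y" using T by (auto simp: y_def algebra_simps)
        show "1 + T \<le> 4 * y" using mult_left_mono[OF l2(1), of "1 + T"] T by (simp add: y_def)
      qed
      have b1: "28 * T + 16 \<le> 176 * y" using y(3) T by linarith
      have b2: "L * total \<le> 96 * total * y"
        using mult_right_mono[OF order_trans[OF L1 mult_left_mono[OF y(1)]] total_nonneg] by (simp add: mult_ac)
      have b3: "L\<^sup>2 * total \<le> 2304 * total * y"
        using mult_right_mono[OF order_trans[OF LL mult_left_mono[OF y(1)]] total_nonneg] by (simp add: mult_ac)
      have b4: "L * total * T \<le> 96 * total * y"
      proof -
        have "L * T \<le> 96 * l\<^sup>2 * T" using L1 T by (intro mult_right_mono) auto
        also have "\<dots> \<le> 96 * y" using y(2) by (simp add: mult_ac)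
        finally show ?thesis using mult_right_mono[OF _ total_nonneg, of "L * T" "96 * y"] by (simp add: mult_ac)
      qed
      have b5: "L\<^sup>2 * total\<^sup>2 \<le> 2304 * total\<^sup>2 * y"
        using mult_right_mono[OF order_trans[OF LL mult_left_mono[OF y(1)]], of "total\<^sup>2"] by (simp add: mult_ac)
      have "B \<le> (28 * T + 16) + 4 * (L * total) + 8 * (L\<^sup>2 * total) + 64 * (L * total * T) + 4 * (L\<^sup>2 * total\<^sup>2)"
        unfolding B_def using mean by (simp add: algebra_simps)
      also have "\<dots> \<le> 176 * y + 4 * (96 * total * y) + 8 * (2304 * total * y) + 64 * (96 * total * y) + 4 * (2304 * total\<^sup>2 * y)"
        by (intro add_mono mult_left_mono b1 b2 b3 b4 b5) auto
      also have "\<dots> = C / 2 * y" by (simp add: C_def algebra_simps)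
      finally show ?thesis by (simp add: y_def)
    qed
    finally show ?thesis by (simp add: H_def T_def l_def)
  qed
  moreover have "0 \<le> C" using total_nonneg by (simp add: C_def)
  ultimately show ?thesis by blast
qed

text \<open>
The distribution of \<open>X t\<close> modulo \<open>1\<close> has Fourier coefficients tending to zero, hence no atom at
zero. Quantitatively, a majorant for a small width \<open>w\<close> has expectation \<open>O(w)\<close> plus \<open>O(w)\<close> from each
of the finitely many low frequencies, plus a tail controlled by its \<open>\<ell>\<^sup>1\<close> norm, which is bounded
independently of \<open>w\<close>.
\<close>

lemma phase_not_integer:
  assumes t: "1 \<le> t"
  shows "AE x in M. dist_int (X t x) > 0"
proof -
  define Z where "Z = {x \<in> space M. dist_int (X t x) \<le> 0}"
  have [measurable]: "Z \<in> events" unfolding Z_def by measurable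
  define L where "L = 16 * ln (8::real)"
  have L: "0 < L" by (simp add: L_def)
  have small: "prob Z \<le> \<epsilon>" if "\<epsilon> > 0" for \<epsilon>
  proof -
    have "0 < \<epsilon> / (2 * L)" using that L by simp
    from LIMSEQ_D[OF phase_tendsto[OF t] this]
    obtain k0 where k0: "\<And>k. k \<ge> k0 \<Longrightarrow> \<bar>expectation (\<lambda>x. cos (2 * pi * real k * X t x))\<bar> < \<epsilon> / (2 * L)"
      by auto
    define w where "w = min (1/2) (\<epsilon> / (2 * (3 + 8 * real k0)))"
    have w: "0 < w" "w \<le> 1/2" "w \<le> \<epsilon> / (2 * (3 + 8 * real k0))"
      unfolding w_def by (use that in simp, rule min.cobounded1, rule min.cobounded2)
    obtain K a where adm: "admissible_coeffs w (1/2) K a" and maj: "\<And>x. of_bool (w > 0 \<and> dist_int x \<le> w) \<le> trig_poly a K x"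
      using trig_majorant[of w "1/2"] w by auto
    define c where "c = (\<lambda>k. expectation (\<lambda>x. cos (2 * pi * real k * X t x)))"
    have c1: "\<bar>c k\<bar> \<le> 1" for k
    proof -
      have "\<bar>c k\<bar> \<le> expectation (\<lambda>x. 1)" unfolding c_def
        by (rule order_trans[OF integral_abs_bound]) (intro integral_mono, auto intro!: integrable_cos integrable_abs)
      then show ?thesis by (simp add: prob_space)
    qed
    have "prob Z = expectation (indicator Z)" by simp
    also have "\<dots> \<le> expectation (\<lambda>x. trig_poly a K (X t x))"
    proof (rule integral_mono)
      show "integrable M (indicator Z :: 'a \<Rightarrow> real)" by (rule integrable_const_bound[where B = 1]) (auto simp: indicator_def)
      show "indicator Z x \<le> trig_poly a K (X t x)" for x
      proof -
        have "indicator Z x \<le> (of_bool (w > 0 \<and> dist_int (X t x) \<le> w) :: real)"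
          using w by (auto simp: Z_def indicator_def)
        then show ?thesis using maj[of "X t x"] by (rule order_trans)
      qed
    qed (rule integrable_trig_poly)
    also have "\<dots> = a 0 + (\<Sum>k=1..K. a k * c k)" by (simp add: expectation_trig_poly c_def)
    also have "\<dots> \<le> 3 * w + (8 * real k0 * w + L * (\<epsilon> / (2 * L)))"
    proof (rule add_mono)
      show "a 0 \<le> 3 * w" using admissible_coeffs_constant_term[OF adm] w by auto
      have "(\<Sum>k=1..K. a k * c k) \<le> (\<Sum>k=1..K. (if k < k0 then 8 * w else 0) + \<bar>a k\<bar> * (\<epsilon> / (2 * L)))"
      proof (rule sum_mono)
        fix k assume k: "k \<in> {1..K}"
        have ac: "a k * c k \<le> \<bar>a k\<bar> * \<bar>c k\<bar>" by (metis abs_ge_self abs_mult)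
        show "a k * c k \<le> (if k < k0 then 8 * w else 0) + \<bar>a k\<bar> * (\<epsilon> / (2 * L))"
        proof (cases "k < k0")
          case True
          have "\<bar>a k\<bar> * \<bar>c k\<bar> \<le> 8 * w * 1"
            using adm k c1[of k] w by (intro mult_mono) (auto simp: admissible_coeffs_def)
          moreover have "0 \<le> \<bar>a k\<bar> * (\<epsilon> / (2 * L))" using that L by auto
          ultimately show ?thesis using ac True by simp
        next
          case False
          have "\<bar>a k\<bar> * \<bar>c k\<bar> \<le> \<bar>a k\<bar> * (\<epsilon> / (2 * L))"
            using k0[of k] False by (intro mult_left_mono) (auto simp: c_def)
          then show ?thesis using ac False by simp
        qed
      qed
      also have "\<dots> = (\<Sum>k=1..K. if k < k0 then 8 * w else 0) + (\<Sum>k=1..K. \<bar>a k\<bar>) * (\<epsilon> / (2 * L))"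
        by (simp only: sum.distrib sum_distrib_right)
      also have "\<dots> \<le> 8 * real k0 * w + L * (\<epsilon> / (2 * L))"
      proof (rule add_mono)
        have "(\<Sum>k=1..K. if k < k0 then 8 * w else 0) = (\<Sum>k\<in>{1..K} \<inter> {..<k0}. 8 * w)"
          by (subst sum.inter_restrict) (auto intro!: sum.cong)
        also have "\<dots> \<le> 8 * real k0 * w"
          using card_mono[of "{..<k0}" "{1..K} \<inter> {..<k0}"] w by simp
        finally show "(\<Sum>k=1..K. if k < k0 then 8 * w else 0) \<le> 8 * real k0 * w" .
        show "(\<Sum>k=1..K. \<bar>a k\<bar>) * (\<epsilon> / (2 * L)) \<le> L * (\<epsilon> / (2 * L))"
          using adm that L by (intro mult_right_mono) (auto simp: admissible_coeffs_def L_def)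
      qed
      finally show "(\<Sum>k=1..K. a k * c k) \<le> 8 * real k0 * w + L * (\<epsilon> / (2 * L))" .
    qed
    also have "\<dots> = (3 + 8 * real k0) * w + \<epsilon> / 2" using L by (simp add: algebra_simps)
    also have "\<dots> \<le> (3 + 8 * real k0) * (\<epsilon> / (2 * (3 + 8 * real k0))) + \<epsilon> / 2"
      using w by (intro add_right_mono mult_left_mono) auto
    also have "(3 + 8 * real k0) * (\<epsilon> / (2 * (3 + 8 * real k0))) = \<epsilon> / 2"
    proof -
      have "z * (\<epsilon> / (2 * z)) = \<epsilon> / 2" if "z \<noteq> 0" for z :: real using that by simp
      moreover have "3 + 8 * real k0 \<noteq> 0" by linarith
      ultimately show ?thesis by blast
    qed
    finally show ?thesis by simp
  qed
  have "prob Z \<le> 0"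
    by (rule field_le_epsilon, unfold add_0, rule small)
  then have "prob Z = 0" using measure_nonneg[of M Z] by (rule antisym)
  then have "AE x in M. x \<notin> Z" using prob_eq_0[of Z] by simp
  then show ?thesis using AE_space by eventually_elim (simp add: Z_def)
qed

theorem counting_asymptotics:
  assumes w: "\<And>t. 1 \<le> t \<Longrightarrow> 0 \<le> w t" "\<And>t. 1 \<le> t \<Longrightarrow> w t \<le> 1 / 2"
  shows "AE x in M. \<exists>C. \<forall>N. \<bar>real (card {t \<in> {1..N}. dist_int (X t x) \<le> w t}) - 2 * (\<Sum>t=1..N. w t)\<bar>
      \<le> C * error_scale (\<Sum>t=1..N. w t)"
proof -
  have "\<exists>C\<ge>0. \<forall>N. expectation (\<lambda>x. ((\<Sum>t=1..N. indicator (hit w t) x) - 2 * (\<Sum>t=1..N. w t))\<^sup>2)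
      \<le> C * (1 + (\<Sum>t=1..N. w t)) * ln (2 + (\<Sum>t=1..N. w t)) ^ 2"
    by (rule variance_of_hits) (erule w)+
  then obtain C where C: "0 \<le> C" and var: "\<forall>N. expectation (\<lambda>x. ((\<Sum>t=1..N. indicator (hit w t) x) - 2 * (\<Sum>t=1..N. w t))\<^sup>2)
      \<le> C * (1 + (\<Sum>t=1..N. w t)) * ln (2 + (\<Sum>t=1..N. w t)) ^ 2"
    by (elim exE conjE)
  have "AE x in M. \<exists>C. \<forall>N. \<bar>(\<Sum>t=1..N. indicator (hit w t) x) - 2 * (\<Sum>t=1..N. w t)\<bar> \<le> C * error_scale (\<Sum>t=1..N. w t)"
  proof (rule count_asymptotics_from_variance[where A = "hit w" and w = w and C = C])
    show "hit w t = {}" if "w t = 0" for t using that by (simp add: hit_def)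
  qed (use w C var in \<open>simp_all add: hit_event\<close>)
  moreover have "AE x in M. \<forall>t\<ge>1. dist_int (X t x) > 0"
  proof (subst AE_all_countable, rule allI)
    show "AE x in M. 1 \<le> t \<longrightarrow> dist_int (X t x) > 0" for t
      using phase_not_integer[of t] by (cases "1 \<le> t") auto
  qed
  ultimately show ?thesis
    using AE_space
  proof eventually_elim
    case (elim x)
    have "(\<Sum>t=1..N. indicator (hit w t) x) = real (card {t \<in> {1..N}. dist_int (X t x) \<le> w t})" for N
    proof -
      have "(\<Sum>t=1..N. indicator (hit w t) x) = (\<Sum>t=1..N. of_bool (dist_int (X t x) \<le> w t) :: real)"
      proof (rule sum.cong[OF refl])
        fix t assume "t \<in> {1..N}"
        then have "dist_int (X t x) > 0" using elim(2) by auto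
        then show "indicator (hit w t) x = (of_bool (dist_int (X t x) \<le> w t) :: real)"
          using elim(3) by (auto simp: hit_def indicator_def)
      qed
      also have "\<dots> = real (card {t \<in> {1..N}. dist_int (X t x) \<le> w t})"
        by (simp add: of_bool_def sum.If_cases Int_def)
      finally show ?thesis .
    qed
    then show ?case using elim(1) by simp
  qed
qed

end

section \<open>Lacunary dilations under logarithmic Fourier decay\<close>

lemma cmod_fourier_le_1:
  assumes "prob_space \<nu>"
  shows "cmod (fourier \<nu> \<xi>) \<le> 1"
proof -
  interpret prob_space \<nu> by fact
  have "cmod (fourier \<nu> \<xi>) \<le> (\<integral>x. cmod (e (- (\<xi> \<bullet> x))) \<partial>\<nu>)"
    unfolding fourier_def by (rule integral_norm_bound)
  also have "\<dots> = 1" by (simp add: e_def prob_space)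
  finally show ?thesis .
qed

lemma abs_cos_integral_le_fourier:
  assumes "prob_space \<nu>" and sets[measurable_cong]: "sets \<nu> = sets borel"
  shows "\<bar>\<integral>x. cos (2 * pi * (a * fst x + b * snd x)) \<partial>\<nu>\<bar> \<le> cmod (fourier \<nu> (a, b))"
proof -
  interpret prob_space \<nu> by fact
  have cis: "e (- ((a, b) \<bullet> x)) = cis (- (2 * pi * (a * fst x + b * snd x)))" for x
    by (cases x) (simp add: e_def cis_conv_exp algebra_simps)
  have "(\<lambda>x. cis (- (2 * pi * (a * fst x + b * snd x)))) \<in> borel_measurable borel"
    by (intro borel_measurable_continuous_onI continuous_intros)
  then have [measurable]: "(\<lambda>x. cis (- (2 * pi * (a * fst x + b * snd x)))) \<in> borel_measurable \<nu>"
    using measurable_cong_sets[OF sets refl] by blast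
  have "integrable \<nu> (\<lambda>x. cis (- (2 * pi * (a * fst x + b * snd x))))"
    by (rule integrable_const_bound[where B = 1]) auto
  then have "(\<integral>x. Re (cis (- (2 * pi * (a * fst x + b * snd x)))) \<partial>\<nu>) = Re (fourier \<nu> (a, b))"
    unfolding fourier_def cis by (rule integral_Re)
  then show ?thesis using abs_Re_le_cmod[of "fourier \<nu> (a, b)"] by simp
qed

text \<open>
At frequencies of size about \<open>c\<^sup>u\<close> logarithmic decay becomes decay like \<open>u\<^sup>-\<^sup>A\<close>. The factor \<open>\<kappa>\<close> and the
shift \<open>b\<close> allow frequencies that are only comparable to \<open>c\<^sup>u\<close>. The finitely many small \<open>u\<close> are covered
by the trivial bound \<open>1\<close> on the transform and a larger constant.
\<close>

lemma fourier_decay_along_geometric: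
  assumes A: "A > 0" and prob: "prob_space \<nu>" and decay: "fourier_log_decay A \<nu>"
    and c: "c > 1" and \<kappa>: "\<kappa> > 0"
  shows "\<exists>D\<ge>0. \<forall>u\<ge>1. \<forall>\<xi>. sup_norm \<xi> \<ge> \<kappa> * c ^ u - b \<longrightarrow>
    cmod (fourier \<nu> (of_int (fst \<xi>), of_int (snd \<xi>))) \<le> D * real u powr (- A)"
proof -
  define F where "F = (\<lambda>\<xi>::int\<times>int. cmod (fourier \<nu> (of_int (fst \<xi>), of_int (snd \<xi>))))"
  obtain C where C: "C > 0" and ev: "eventually (\<lambda>\<xi>. norm (F \<xi>) \<le> C * norm (ln (sup_norm \<xi>) powr (- A))) (filtercomap sup_norm at_top)"
    using decay unfolding fourier_log_decay_def F_def by (elim landau_o.bigE)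
  from ev obtain R where "\<And>\<xi>. sup_norm \<xi> \<ge> R \<Longrightarrow> norm (F \<xi>) \<le> C * norm (ln (sup_norm \<xi>) powr (- A))"
    unfolding eventually_filtercomap_at_top_linorder by blast
  then have R: "\<And>\<xi>. sup_norm \<xi> \<ge> R \<Longrightarrow> F \<xi> \<le> C * ln (sup_norm \<xi>) powr (- A)"
    by (auto simp: F_def)
  \<comment> \<open>With \<open>y = exp (\<sigma> u)\<close> one has \<open>c\<^sup>u = y\<^sup>2\<close>, so \<open>\<kappa> c\<^sup>u - b \<ge> y\<close> for large \<open>u\<close>.\<close>
  define \<sigma> where "\<sigma> = ln c / 2"
  have \<sigma>: "\<sigma> > 0" using c by (simp add: \<sigma>_def)
  define Y where "Y = max (max 1 R) ((1 + \<bar>b\<bar>) / \<kappa>)"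
  have "eventually (\<lambda>u::nat. exp (\<sigma> * real u) \<ge> Y) sequentially"
  proof -
    have "filterlim (\<lambda>u::nat. exp (\<sigma> * real u)) at_top sequentially"
      using \<sigma> by real_asymp
    then show ?thesis by (simp add: filterlim_at_top)
  qed
  then obtain u0 where u0: "\<And>u. u \<ge> u0 \<Longrightarrow> exp (\<sigma> * real u) \<ge> Y" by (auto simp: eventually_sequentially)
  define D where "D = C * \<sigma> powr (- A) + real u0 powr A"
  have "F \<xi> \<le> D * real u powr (- A)" if u: "u \<ge> 1" and \<xi>: "sup_norm \<xi> \<ge> \<kappa> * c ^ u - b" for u \<xi>
  proof (cases "u \<ge> u0")
    case True
    define y where "y = exp (\<sigma> * real u)"
    have y: "1 \<le> y" "R \<le> y" "(1 + \<bar>b\<bar>) / \<kappa> \<le> y" using u0[OF True] by (auto simp: y_def Y_def)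
    have "c ^ u = y * y"
    proof -
      have "c ^ u = exp (real u * ln c)" using c by (simp add: exp_of_nat_mult)
      also have "\<dots> = y * y" by (simp add: y_def \<sigma>_def flip: exp_add)
      finally show ?thesis .
    qed
    have "y \<le> \<kappa> * c ^ u - b"
    proof -
      have "1 + \<bar>b\<bar> \<le> \<kappa> * y" using y(3) \<kappa> by (simp add: pos_divide_le_eq mult.commute)
      then have "(1 + \<bar>b\<bar>) * y \<le> \<kappa> * y * y" using y by (intro mult_right_mono) auto
      moreover have "\<bar>b\<bar> * 1 \<le> \<bar>b\<bar> * y" using y by (intro mult_left_mono) auto
      ultimately show ?thesis using \<open>c ^ u = y * y\<close> by (simp add: algebra_simps)
    qed
    with \<xi> have ys: "y \<le> sup_norm \<xi>" by linarith
    have "\<sigma> * real u = ln y" by (simp add: y_def)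
    also have "\<dots> \<le> ln (sup_norm \<xi>)" using ys y by simp
    finally have l: "\<sigma> * real u \<le> ln (sup_norm \<xi>)" .
    have "F \<xi> \<le> C * ln (sup_norm \<xi>) powr (- A)" using ys y(2) by (intro R) linarith
    also have "\<dots> \<le> C * (\<sigma> * real u) powr (- A)"
      using C l \<sigma> u A by (intro mult_left_mono powr_mono2') auto
    also have "\<dots> = C * \<sigma> powr (- A) * real u powr (- A)" using \<sigma> by (simp add: powr_mult)
    also have "\<dots> \<le> D * real u powr (- A)" by (intro mult_right_mono) (auto simp: D_def)
    finally show ?thesis .
  next
    case False
    have "F \<xi> \<le> 1" unfolding F_def by (rule cmod_fourier_le_1[OF prob])
    also have "1 = real u powr A * real u powr (- A)" using u by (simp flip: powr_add)
    also have "\<dots> \<le> D * real u powr (- A)"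
    proof (rule mult_right_mono)
      have "real u powr A \<le> real u0 powr A" using False A by (intro powr_mono2) auto
      also have "\<dots> \<le> D" using C by (simp add: D_def)
      finally show "real u powr A \<le> D" .
    qed simp
    finally show ?thesis .
  qed
  moreover have "D \<ge> 0" using C by (simp add: D_def)
  ultimately show ?thesis unfolding F_def by blast
qed

lemma lacunary_growth:
  fixes n :: "nat \<Rightarrow> nat"
  assumes c: "c > 0" and lac: "\<And>t. t \<ge> 1 \<Longrightarrow> real (n (Suc t)) \<ge> c * real (n t)" and "1 \<le> s"
  shows "c ^ d * real (n s) \<le> real (n (s + d))"
proof (induction d)
  case (Suc d)
  have "c ^ Suc d * real (n s) = c * (c ^ d * real (n s))" by simp
  also have "\<dots> \<le> c * real (n (s + d))" using Suc c by (intro mult_left_mono) auto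
  also have "\<dots> \<le> real (n (s + Suc d))" using lac[of "s + d"] \<open>1 \<le> s\<close> by simp
  finally show ?case .
qed simp

text \<open>
The expectations required are real parts of the Fourier transform at \<open>(k n\<^sub>t, -k)\<close> and
\<open>(k n\<^sub>s \<plusminus> l n\<^sub>t, -(k \<plusminus> l))\<close>. The frequency \<open>l\<close> is resonant for \<open>k\<close> if
\<open>|k n\<^sub>s - l n\<^sub>t| < n\<^sub>t/2\<close>, which two different \<open>l\<close> cannot satisfy. When moreover
\<open>|k n\<^sub>s - l n\<^sub>t| < n\<^sub>s/2\<close>, the ratio \<open>k/l\<close> is close to \<open>n\<^sub>t/n\<^sub>s \<ge> c\<^sup>t\<^sup>-\<^sup>s\<close>, and the second coordinate
\<open>k - l\<close> is large.
\<close>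

lemma decorrelated_phases_lacunary:
  fixes n :: "nat \<Rightarrow> nat"
  assumes A: "A > 2" and prob: "prob_space \<nu>" and sets[measurable_cong]: "sets \<nu> = sets borel"
    and decay: "fourier_log_decay A \<nu>"
    and pos: "\<And>t. t \<ge> 1 \<Longrightarrow> n t > 0" and lac: "lacunary n"
  shows "\<exists>D. decorrelated_phases \<nu> (\<lambda>t x. real (n t) * fst x - snd x) (\<lambda>t. D * real t powr (- A))"
proof -
  interpret prob_space \<nu> by fact
  obtain c where c: "c > 1" and step: "\<And>t. t \<ge> 1 \<Longrightarrow> real (n (Suc t)) \<ge> c * real (n t)"
    using lac by (auto simp: lacunary_def)
  have growth: "c ^ (t - s) * real (n s) \<le> real (n t)" if "1 \<le> s" "s \<le> t" for s t
    using lacunary_growth[of c n s "t - s"] step c that by auto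
  have n1: "real (n t) \<ge> 1" if "1 \<le> t" for t using pos[OF that] by simp
  have n_ge: "c ^ t / c \<le> real (n t)" if "1 \<le> t" for t
  proof -
    have "c ^ t / c = c ^ (t - 1)" using c that by (simp add: power_diff)
    also have "\<dots> \<le> c ^ (t - 1) * real (n 1)" using n1[of 1] c by simp
    also have "\<dots> \<le> real (n t)" using growth[of 1 t] that by simp
    finally show ?thesis .
  qed
  define \<kappa> where "\<kappa> = 1 / (2 * c)"
  have \<kappa>: "\<kappa> > 0" "\<kappa> \<le> 1" using c by (auto simp: \<kappa>_def)
  have n_half: "\<kappa> * c ^ t - 3/2 \<le> real (n t) / 2" if "1 \<le> t" for t
    using n_ge[OF that] by (simp add: \<kappa>_def)
  obtain D where D: "D \<ge> 0" and dec: "\<And>u \<xi>. u \<ge> 1 \<Longrightarrow> sup_norm \<xi> \<ge> \<kappa> * c ^ u - 3/2 \<Longrightarrow>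
      cmod (fourier \<nu> (of_int (fst \<xi>), of_int (snd \<xi>))) \<le> D * real u powr (- A)"
    using fourier_decay_along_geometric[of A \<nu> c \<kappa> "3/2"] A prob decay c \<kappa> by auto
  define \<rho> where "\<rho> = (\<lambda>t::nat. D * real t powr (- A))"
  have main: "\<bar>expectation (\<lambda>x. cos (2 * pi * (of_int a * fst x + of_int b * snd x)))\<bar> \<le> \<rho> u"
    if "u \<ge> 1" "\<kappa> * c ^ u - 3/2 \<le> \<bar>real_of_int a\<bar> \<or> \<kappa> * c ^ u - 3/2 \<le> \<bar>real_of_int b\<bar>" for a b :: int and u
  proof -
    have le: "\<bar>expectation (\<lambda>x. cos (2 * pi * (of_int a * fst x + of_int b * snd x)))\<bar> \<le> cmod (fourier \<nu> (of_int a, of_int b))"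
      by (rule abs_cos_integral_le_fourier[OF prob sets])
    have "\<bar>real_of_int a\<bar> \<le> sup_norm (a, b)" "\<bar>real_of_int b\<bar> \<le> sup_norm (a, b)"
      by (simp_all add: sup_norm_def flip: of_int_abs)
    then have "\<kappa> * c ^ u - 3/2 \<le> sup_norm (a, b)" using that(2) by linarith
    then have "cmod (fourier \<nu> (of_int a, of_int b)) \<le> \<rho> u"
      using dec[OF that(1), of "(a, b)"] by (simp add: \<rho>_def)
    with le show ?thesis by (rule order_trans)
  qed
  have "decorrelated_phases \<nu> (\<lambda>t x. real (n t) * fst x - snd x) \<rho>"
  proof
    show "(\<lambda>x. real (n t) * fst x - snd x) \<in> borel_measurable \<nu>" for t
    proof -
      have "(\<lambda>x::real\<times>real. real (n t) * fst x - snd x) \<in> borel_measurable borel"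
        by (intro borel_measurable_continuous_onI continuous_intros)
      then show ?thesis using measurable_cong_sets[OF sets refl] by blast
    qed
    show "0 \<le> \<rho> t" for t using D by (simp add: \<rho>_def)
    show "summable (\<lambda>t. real t * \<rho> t)"
    proof -
      have "summable (\<lambda>t. D * real t powr (1 - A))"
        using A by (intro summable_mult) (simp add: summable_real_powr_iff)
      moreover have "D * real t powr (1 - A) = real t * \<rho> t" for t
        by (cases "t = 0") (simp_all add: \<rho>_def powr_diff powr_minus_divide)
      ultimately show ?thesis by simp
    qed
    show "\<bar>expectation (\<lambda>x. cos (2 * pi * real k * (real (n t) * fst x - snd x)))\<bar> \<le> \<rho> t"
      if "1 \<le> t" "1 \<le> k" for t k
    proof -
      have "real (n t) \<le> real (k * n t)" unfolding of_nat_le_iff using that by simp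
      then have "\<kappa> * c ^ t - 3/2 \<le> real (k * n t)"
        using n_half[OF that(1)] n1[OF that(1)] by linarith
      then have "\<bar>expectation (\<lambda>x. cos (2 * pi * (of_int (int (k * n t)) * fst x + of_int (- int k) * snd x)))\<bar> \<le> \<rho> t"
        by (intro main that disjI1) (simp only: of_int_of_nat_eq abs_of_nat)
      then show ?thesis by (simp add: algebra_simps)
    qed
    show "(\<lambda>k. expectation (\<lambda>x. cos (2 * pi * real k * (real (n t) * fst x - snd x)))) \<longlonglongrightarrow> 0" if "1 \<le> t" for t
    proof (rule LIMSEQ_I)
      fix r :: real assume r: "0 < r"
      have "\<rho> \<longlonglongrightarrow> 0" unfolding \<rho>_def using A by real_asymp
      then have "eventually (\<lambda>u. \<rho> u < r) sequentially" using r by (rule order_tendstoD(2))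
      then have "eventually (\<lambda>u. \<rho> u < r \<and> u \<ge> 1) sequentially"
        using eventually_ge_at_top[of 1] by (rule eventually_conj)
      then obtain u where u: "\<rho> u < r" "u \<ge> 1" by (auto dest: eventually_happens)
      have "norm (expectation (\<lambda>x. cos (2 * pi * real k * (real (n t) * fst x - snd x))) - 0) < r"
        if k: "k \<ge> nat \<lceil>\<kappa> * c ^ u\<rceil>" for k
      proof -
        have "\<kappa> * c ^ u \<le> real k" using k by linarith
        then have "\<bar>expectation (\<lambda>x. cos (2 * pi * (of_int (int (k * n t)) * fst x + of_int (- int k) * snd x)))\<bar> \<le> \<rho> u"
          by (intro main u disjI2) simp
        then show ?thesis using u by (simp add: algebra_simps)
      qed
      then show "\<exists>no. \<forall>k\<ge>no. norm (expectation (\<lambda>x. cos (2 * pi * real k * (real (n t) * fst x - snd x))) - 0) < r"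
        by blast
    qed
    show "\<bar>expectation (\<lambda>x. cos (2 * pi * real k * (real (n s) * fst x - snd x) + 2 * pi * real l * (real (n t) * fst x - snd x)))\<bar> \<le> \<rho> t"
      if "1 \<le> s" "s < t" "1 \<le> k" "1 \<le> l" for s t k l
    proof -
      have t: "1 \<le> t" using that by simp
      have "real (n t) \<le> real (l * n t)" unfolding of_nat_le_iff using that by simp
      also have "\<dots> \<le> real (k * n s + l * n t)" by simp
      finally have "\<kappa> * c ^ t - 3/2 \<le> real (k * n s + l * n t)"
        using n_half[OF t] n1[OF t] by linarith
      then have "\<bar>expectation (\<lambda>x. cos (2 * pi * (of_int (int (k * n s + l * n t)) * fst x + of_int (- int (k + l)) * snd x)))\<bar> \<le> \<rho> t"
        by (intro main t disjI1) (simp only: of_int_of_nat_eq abs_of_nat)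
      then show ?thesis by (simp add: algebra_simps)
    qed
    show "\<exists>l0. \<forall>l\<ge>1. \<bar>expectation (\<lambda>x. cos (2 * pi * real k * (real (n s) * fst x - snd x) - 2 * pi * real l * (real (n t) * fst x - snd x)))\<bar>
        \<le> (if l = l0 then \<rho> s + \<rho> (t - s) else \<rho> t)"
      if st: "1 \<le> s" "s < t" and k: "1 \<le> k" for s t k
    proof -
      have t: "1 \<le> t" using st by simp
      have nt: "real (n t) \<ge> 1" "real (n s) \<ge> 1" using n1 st by auto
      have \<rho>0: "0 \<le> \<rho> u" for u using D by (simp add: \<rho>_def)
      \<comment> \<open>\<open>\<Delta> l\<close> is the first coordinate of the frequency.\<close>
      define \<Delta> where "\<Delta> = (\<lambda>l. real k * real (n s) - real l * real (n t))"
      define l0 where "l0 = (SOME l. \<bar>\<Delta> l\<bar> < real (n t) / 2)"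
      have uniq: "l = l0" if "\<bar>\<Delta> l\<bar> < real (n t) / 2" for l
      proof -
        have "\<bar>\<Delta> l0\<bar> < real (n t) / 2" unfolding l0_def using that by (rule someI)
        moreover have "\<Delta> l0 - \<Delta> l = (real l - real l0) * real (n t)" by (simp add: \<Delta>_def algebra_simps)
        ultimately have "\<bar>(real l - real l0) * real (n t)\<bar> < 1 * real (n t)"
          using that by linarith
        then have "\<bar>real l - real l0\<bar> * real (n t) < 1 * real (n t)"
          by (simp only: abs_mult abs_of_nat)
        then have "\<bar>real l - real l0\<bar> < 1"
          by (rule mult_right_less_imp_less) simp
        then show ?thesis by linarith
      qed
      have "\<bar>expectation (\<lambda>x. cos (2 * pi * real k * (real (n s) * fst x - snd x) - 2 * pi * real l * (real (n t) * fst x - snd x)))\<bar>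
        \<le> (if l = l0 then \<rho> s + \<rho> (t - s) else \<rho> t)" if l: "1 \<le> l" for l
      proof -
        have eq: "2 * pi * real k * (real (n s) * fst x - snd x) - 2 * pi * real l * (real (n t) * fst x - snd x)
          = 2 * pi * (of_int (int k * int (n s) - int l * int (n t)) * fst x + of_int (int l - int k) * snd x)" for x :: "real \<times> real"
          by (simp add: algebra_simps)
        have \<Delta>: "real_of_int (int k * int (n s) - int l * int (n t)) = \<Delta> l" by (simp add: \<Delta>_def)
        consider "\<bar>\<Delta> l\<bar> \<ge> real (n t) / 2" "l \<noteq> l0" | "l = l0" "\<bar>\<Delta> l\<bar> \<ge> real (n s) / 2" | "l = l0" "\<bar>\<Delta> l\<bar> < real (n s) / 2"
          using uniq[of l] by linarith
        then show ?thesis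
        proof cases
          case 1
          then show ?thesis unfolding eq
            using n_half[OF t] by (simp only: if_False) (intro main t disjI1, unfold \<Delta>, linarith)
        next
          case 2
          have "\<bar>expectation (\<lambda>x. cos (2 * pi * (of_int (int k * int (n s) - int l * int (n t)) * fst x + of_int (int l - int k) * snd x)))\<bar> \<le> \<rho> s"
            using n_half[OF st(1)] 2 by (intro main st(1) disjI1, unfold \<Delta>, linarith)
          then show ?thesis unfolding eq using 2 \<rho>0[of "t - s"] by simp
        next
          case 3
          have "c ^ (t - s) - 3/2 \<le> \<bar>real_of_int (int l - int k)\<bar>"
          proof -
            have cl: "c ^ (t - s) \<ge> 1" using c by simp
            have "real l * (c ^ (t - s) * real (n s)) \<le> real l * real (n t)"
              using growth[of s t] st by (intro mult_left_mono) auto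
            then have "(real l * c ^ (t - s) - real k) * real (n s) \<le> - \<Delta> l"
              by (simp add: \<Delta>_def algebra_simps)
            also have "\<dots> < 1 / 2 * real (n s)" using 3 by linarith
            finally have "real l * c ^ (t - s) - real k < 1 / 2"
              by (rule mult_right_less_imp_less) simp
            moreover have "1 * (c ^ (t - s) - 1) \<le> real l * (c ^ (t - s) - 1)"
              using l cl by (intro mult_right_mono) auto
            ultimately have "c ^ (t - s) - 3/2 \<le> real k - real l" by (simp add: right_diff_distrib)
            then show ?thesis by simp
          qed
          moreover have "\<kappa> * c ^ (t - s) \<le> 1 * c ^ (t - s)" using \<kappa> c by (intro mult_right_mono) auto
          ultimately have "\<bar>expectation (\<lambda>x. cos (2 * pi * (of_int (int k * int (n s) - int l * int (n t)) * fst x + of_int (int l - int k) * snd x)))\<bar> \<le> \<rho> (t - s)"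
            using st by (intro main disjI2) linarith+
          then show ?thesis unfolding eq using 3 \<rho>0[of s] by simp
        qed
      qed
      then show ?thesis by blast
    qed
  qed
  then show ?thesis unfolding \<rho>_def by blast
qed

text \<open>
The quantifier over real constants can be restricted to natural numbers, which leaves countable
operations only.
\<close>

lemma sets_regular_set:
  assumes sets[measurable_cong]: "sets \<nu> = sets borel" and nonneg: "\<And>N. 0 \<le> Psi n \<psi> N"
  shows "regular_set n \<psi> \<in> sets \<nu>"
proof -
  have sp: "space \<nu> = UNIV" using sets_eq_imp_space_eq[OF sets] by simp
  let ?P = "\<lambda>N. Psi n \<psi> N powr (2 / 3) * ln (2 + Psi n \<psi> N) ^ 3"
  have count[measurable]: "(\<lambda>x. real (hit_count n (fst x) (snd x) \<psi> N)) \<in> borel_measurable \<nu>" for N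
  proof -
    have eq: "real (hit_count n (fst x) (snd x) \<psi> N) =
        (\<Sum>t=1..N. indicator {x. dist_int (real (n t) * fst x - snd x) \<le> \<psi> (n t)} x)" for x
    proof -
      have "real (hit_count n (fst x) (snd x) \<psi> N) =
          (\<Sum>t=1..N. if dist_int (real (n t) * fst x - snd x) \<le> \<psi> (n t) then 1 else 0)"
        by (simp add: hit_count_def sum.If_cases Int_def)
      also have "\<dots> = (\<Sum>t=1..N. indicator {x. dist_int (real (n t) * fst x - snd x) \<le> \<psi> (n t)} x)"
        by (rule sum.cong) (auto simp: indicator_def)
      finally show ?thesis .
    qed
    have "closed {x::real\<times>real. dist_int (real (n t) * fst x - snd x) \<le> \<psi> (n t)}" for t
      unfolding dist_int_def by (intro closed_Collect_le continuous_intros)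
    then have "{x::real\<times>real. dist_int (real (n t) * fst x - snd x) \<le> \<psi> (n t)} \<in> sets \<nu>" for t
      unfolding sets by (rule borel_closed)
    then show ?thesis unfolding eq by measurable
  qed
  have "regular_set n \<psi> = {x \<in> space \<nu>. \<exists>i::nat. \<forall>N.
      \<bar>real (hit_count n (fst x) (snd x) \<psi> N) - 2 * Psi n \<psi> N\<bar> \<le> real i * ?P N}"
  proof -
    have bound_by_nat: "(\<exists>C. \<forall>N. g N \<le> C * ?P N) \<longleftrightarrow> (\<exists>i::nat. \<forall>N. g N \<le> real i * ?P N)" for g :: "nat \<Rightarrow> real"
    proof
      assume "\<exists>C. \<forall>N. g N \<le> C * ?P N"
      then obtain C where C: "\<And>N. g N \<le> C * ?P N" by blast
      have "g N \<le> real (nat \<lceil>C\<rceil>) * ?P N" for N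
      proof -
        have "C * ?P N \<le> real (nat \<lceil>C\<rceil>) * ?P N"
          using nonneg[of N] by (intro mult_right_mono real_nat_ceiling_ge) auto
        then show ?thesis using C[of N] by linarith
      qed
      then show "\<exists>i::nat. \<forall>N. g N \<le> real i * ?P N" by blast
    qed blast
    show ?thesis unfolding regular_set_def sp bound_by_nat by (simp add: case_prod_beta')
  qed
  also have "\<dots> \<in> sets \<nu>" by measurable
  finally show ?thesis .
qed

(* The hypothesis half cannot be dropped: the distance to the nearest integer never exceeds 1/2,
   so for \<psi> = 1 every t is counted and the count is N, whereas 2 \<Psi>(N) = 2 N. *)
theorem theorem1p9:
  fixes A :: real and \<nu> :: "(real \<times> real) measure"
    and n :: "nat \<Rightarrow> nat" and \<psi> :: "nat \<Rightarrow> real"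
  assumes A: "A > 2"
    and prob: "prob_space \<nu>"
    and sets: "sets \<nu> = sets borel"
    and supp: "AE x in \<nu>. x \<in> {0..1} \<times> {0..1}"
    and decay: "fourier_log_decay A \<nu>"
    and pos: "\<And>t. t \<ge> 1 \<Longrightarrow> n t > 0"
    and lac: "lacunary n"
    and psi: "\<And>m. m \<ge> 1 \<Longrightarrow> \<psi> m \<in> {0..1}"
    and half: "\<And>t. t \<ge> 1 \<Longrightarrow> \<psi> (n t) \<le> 1 / 2"
  shows "measure \<nu> (regular_set n \<psi>) = 1"
proof -
  obtain D where "decorrelated_phases \<nu> (\<lambda>t x. real (n t) * fst x - snd x) (\<lambda>t. D * real t powr (- A))"
    using decorrelated_phases_lacunary[OF A prob sets decay pos lac] by blast
  then interpret decorrelated_phases \<nu> "\<lambda>t x. real (n t) * fst x - snd x" "\<lambda>t. D * real t powr (- A)" .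
  have w0: "0 \<le> \<psi> (n t)" if "1 \<le> t" for t
    using psi[of "n t"] pos[OF that] by simp
  have "AE x in \<nu>. \<exists>C. \<forall>N. \<bar>real (card {t \<in> {1..N}. dist_int (real (n t) * fst x - snd x) \<le> \<psi> (n t)})
      - 2 * (\<Sum>t=1..N. \<psi> (n t))\<bar> \<le> C * error_scale (\<Sum>t=1..N. \<psi> (n t))"
    by (rule counting_asymptotics[where w = "\<lambda>t. \<psi> (n t)"]) (use w0 half in auto)
  then have "AE x in \<nu>. x \<in> regular_set n \<psi>"
    by (simp add: regular_set_def hit_count_def Psi_def error_scale_def case_prod_beta')
  moreover have "regular_set n \<psi> \<in> sets \<nu>"
    by (rule sets_regular_set[OF sets]) (auto simp: Psi_def intro!: sum_nonneg w0)
  ultimately show ?thesis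
    using AE_in_set_eq_1 by blast
qed

end
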